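(* Let $E$ be a Banach lattice. Then the following statements are equivalent. (1) For every Banach space $X$, every disjointly weakly compact operator $T:X\to E$ is $L$-weakly compact. (2) Every positive disjointly weakly compact operator $T:\ell_1\to E$ is $L$-weakly compact. (3) Every positive weakly compact operator $T:\ell_1\to E$ is $L$-weakly compact. (4) $E$ has the positive Schur property.
   Context: All Banach spaces and Banach lattices are real; $B_X$ is the closed unit ball of $X$. A sequence $(x_n)$ in a Banach lattice is disjoint if $|x_n|\wedge|x_m|=0$ for $n\neq m$. $Sol(A)=\{x: |x|\le |a| \text{ for some } a\in A\}$ is the solid hull of $A$. A norm bounded set $A$ in a Banach lattice is disjointly weakly compact (resp. $L$-weakly compact) if every disjoint sequence in $Sol(A)$ converges to zero weakly (resp. in norm). A bounded linear operator $T$ from a Banach space $X$ to a Banach lattice is disjointly weakly compact (resp. $L$-weakly compact) if $T(B_X)$ is a disjointly weakly compact (resp. $L$-weakly compact) set. A Banach lattice has the positive Schur property if every weakly null sequence with positive terms is norm null (equivalently, every disjoint weakly null sequence is norm null). *)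

theory Defs
  imports "HOL-Analysis.Analysis" "HOL-Library.Lattice_Algebras"
begin

section \<open>Banach lattices\<close>

class banach_lattice = banach + ordered_real_vector + lattice_ab_group_add_abs +
  assumes norm_lattice_mono: "\<bar>x\<bar> \<le> \<bar>y\<bar> \<Longrightarrow> norm x \<le> norm y"

instance real :: banach_lattice
  by standard (auto simp: sup_real_def)

definition solid_hull :: "'a::banach_lattice set \<Rightarrow> 'a set" where
  "solid_hull A = {x. \<exists>a\<in>A. \<bar>x\<bar> \<le> \<bar>a\<bar>}"

definition disjoint_seq :: "(nat \<Rightarrow> 'a::banach_lattice) \<Rightarrow> bool" where
  "disjoint_seq x \<longleftrightarrow> (\<forall>m n. m \<noteq> n \<longrightarrow> inf \<bar>x m\<bar> \<bar>x n\<bar> = 0)"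


section \<open>The weak topology\<close>

definition weak_topology :: "'a::real_normed_vector topology" where
  "weak_topology =
     topology_generated_by {blinfun_apply f -` U | (f :: 'a \<Rightarrow>\<^sub>L real) U. open U}"

definition weakly_null :: "(nat \<Rightarrow> 'a::real_normed_vector) \<Rightarrow> bool" where
  "weakly_null x \<longleftrightarrow> limitin weak_topology x 0 sequentially"

definition relatively_weakly_compact :: "'a::real_normed_vector set \<Rightarrow> bool" where
  "relatively_weakly_compact A \<longleftrightarrow> compactin weak_topology (weak_topology closure_of A)"


section \<open>Classes of subsets of a Banach lattice\<close>

definition disjointly_weakly_compact :: "'a::banach_lattice set \<Rightarrow> bool" where
  "disjointly_weakly_compact A \<longleftrightarrow> bounded A \<and>
     (\<forall>x. disjoint_seq x \<and> range x \<subseteq> solid_hull A \<longrightarrow> weakly_null x)"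

definition L_weakly_compact :: "'a::banach_lattice set \<Rightarrow> bool" where
  "L_weakly_compact A \<longleftrightarrow> bounded A \<and>
     (\<forall>x. disjoint_seq x \<and> range x \<subseteq> solid_hull A \<longrightarrow> x \<longlonglongrightarrow> 0)"

definition positive_Schur_property :: "'a::banach_lattice itself \<Rightarrow> bool" where
  "positive_Schur_property _ \<longleftrightarrow>
     (\<forall>x :: nat \<Rightarrow> 'a. (\<forall>n. 0 \<le> x n) \<and> weakly_null x \<longrightarrow> x \<longlonglongrightarrow> 0)"


section \<open>Banach spaces on a carrier set\<close>

text \<open>The type class \<open>banach\<close> cannot be quantified over inside a formula. A domain space
  that has to be quantified over is therefore a record of a carrier and operations; the
  values of the operations outside the carrier are irrelevant.

  ``Every Banach space'' ranges over the spaces with elements in \<open>'x + (nat \<Rightarrow> real)\<close>, where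
  the free type variable \<open>'x\<close> plays the role of a universe: every Banach space has a copy
  carried by \<open>range Inl\<close> for a suitable \<open>'x\<close>. The second summand has room for a copy of
  \<open>\<ell>\<^sub>1\<close>; a universe without such room can be too small (on a finite type, every Banach
  space is trivial).\<close>

record 'x nspace =
  ns_carrier :: "'x set"
  ns_zero :: 'x
  ns_add :: "'x \<Rightarrow> 'x \<Rightarrow> 'x"
  ns_scale :: "real \<Rightarrow> 'x \<Rightarrow> 'x"
  ns_norm :: "'x \<Rightarrow> real"

definition ns_dist :: "'x nspace \<Rightarrow> 'x \<Rightarrow> 'x \<Rightarrow> real" where
  "ns_dist X x y = ns_norm X (ns_add X x (ns_scale X (- 1) y))"

definition ns_ball :: "'x nspace \<Rightarrow> 'x set" where
  "ns_ball X = {x \<in> ns_carrier X. ns_norm X x \<le> 1}"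

locale banach_space =
  fixes X :: "'x nspace"
  assumes zero_closed: "ns_zero X \<in> ns_carrier X"
    and add_closed: "\<lbrakk>x \<in> ns_carrier X; y \<in> ns_carrier X\<rbrakk> \<Longrightarrow> ns_add X x y \<in> ns_carrier X"
    and scale_closed: "x \<in> ns_carrier X \<Longrightarrow> ns_scale X c x \<in> ns_carrier X"
    and add_assoc: "\<lbrakk>x \<in> ns_carrier X; y \<in> ns_carrier X; z \<in> ns_carrier X\<rbrakk>
          \<Longrightarrow> ns_add X (ns_add X x y) z = ns_add X x (ns_add X y z)"
    and add_commute: "\<lbrakk>x \<in> ns_carrier X; y \<in> ns_carrier X\<rbrakk> \<Longrightarrow> ns_add X x y = ns_add X y x"
    and add_zero: "x \<in> ns_carrier X \<Longrightarrow> ns_add X x (ns_zero X) = x"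
    and add_inverse: "x \<in> ns_carrier X \<Longrightarrow> \<exists>y\<in>ns_carrier X. ns_add X x y = ns_zero X"
    and scale_add_right: "\<lbrakk>x \<in> ns_carrier X; y \<in> ns_carrier X\<rbrakk>
          \<Longrightarrow> ns_scale X c (ns_add X x y) = ns_add X (ns_scale X c x) (ns_scale X c y)"
    and scale_add_left: "x \<in> ns_carrier X
          \<Longrightarrow> ns_scale X (c + d) x = ns_add X (ns_scale X c x) (ns_scale X d x)"
    and scale_scale: "x \<in> ns_carrier X \<Longrightarrow> ns_scale X c (ns_scale X d x) = ns_scale X (c * d) x"
    and scale_one: "x \<in> ns_carrier X \<Longrightarrow> ns_scale X 1 x = x"
    and norm_nonneg: "x \<in> ns_carrier X \<Longrightarrow> 0 \<le> ns_norm X x"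
    and norm_eq_zero: "x \<in> ns_carrier X \<Longrightarrow> ns_norm X x = 0 \<longleftrightarrow> x = ns_zero X"
    and norm_triangle: "\<lbrakk>x \<in> ns_carrier X; y \<in> ns_carrier X\<rbrakk>
          \<Longrightarrow> ns_norm X (ns_add X x y) \<le> ns_norm X x + ns_norm X y"
    and norm_scale: "x \<in> ns_carrier X \<Longrightarrow> ns_norm X (ns_scale X c x) = \<bar>c\<bar> * ns_norm X x"
    and complete: "Metric_space.mcomplete (ns_carrier X) (ns_dist X)"

text \<open>Every Banach space given as a type, transported along an injection into another type,
  is an instance.\<close>

lemma banach_space_transport:
  fixes f :: "'a::banach \<Rightarrow> 'x"
  assumes f: "inj f"
  shows "banach_space
    \<lparr>ns_carrier = range f, ns_zero = f 0,
     ns_add = (\<lambda>x y. f (inv f x + inv f y)), ns_scale = (\<lambda>c x. f (c *\<^sub>R inv f x)),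
     ns_norm = (\<lambda>x. norm (inv f x))\<rparr>" (is "banach_space ?X")
proof -
  have d: "ns_dist ?X (f a) (f b) = dist a b" for a b
    using f by (simp add: ns_dist_def dist_norm)
  interpret M: Metric_space "range f" "ns_dist ?X"
  proof
    fix x y show "0 \<le> ns_dist ?X x y" by (simp add: ns_dist_def)
    show "ns_dist ?X x y = ns_dist ?X y x"
      using f by (simp add: ns_dist_def norm_minus_commute)
  qed (use d f in \<open>auto simp: inj_eq dist_triangle\<close>)
  have "M.mcomplete"
    unfolding M.mcomplete_def
  proof (intro allI impI)
    fix s assume s: "M.MCauchy s"
    then have "range s \<subseteq> range f" by (simp add: M.MCauchy_def)
    then have "\<exists>t. \<forall>n. s n = f (t n)" by (intro choice) blast
    then obtain t where t: "\<And>n. s n = f (t n)" by blast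
    have "Cauchy t"
      using s by (auto simp: M.MCauchy_def Cauchy_def t d)
    then obtain l where l: "t \<longlonglongrightarrow> l"
      by (auto simp: Cauchy_convergent_iff convergent_def)
    then have "limitin M.mtopology s (f l) sequentially"
      by (auto simp: M.limitin_metric t d tendsto_iff)
    then show "\<exists>x. limitin M.mtopology s x sequentially" ..
  qed
  moreover have "\<exists>y. f (a + inv f (f y)) = f 0" for a
    by (rule exI[of _ "- a"]) (simp add: f)
  ultimately show ?thesis
    using f by unfold_locales
      (auto simp: algebra_simps inj_eq norm_triangle_ineq)
qed

definition ell1 :: "(nat \<Rightarrow> real) nspace" where
  "ell1 = \<lparr>ns_carrier = {x. summable (\<lambda>n. \<bar>x n\<bar>)}, ns_zero = (\<lambda>n. 0),
     ns_add = (\<lambda>x y n. x n + y n), ns_scale = (\<lambda>c x n. c * x n),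
     ns_norm = (\<lambda>x. \<Sum>n. \<bar>x n\<bar>)\<rparr>"


section \<open>Operators into a Banach lattice\<close>

definition bounded_operator :: "'x nspace \<Rightarrow> ('x \<Rightarrow> 'e::real_normed_vector) \<Rightarrow> bool" where
  "bounded_operator X T \<longleftrightarrow>
     (\<forall>x\<in>ns_carrier X. \<forall>y\<in>ns_carrier X. T (ns_add X x y) = T x + T y) \<and>
     (\<forall>x\<in>ns_carrier X. \<forall>c. T (ns_scale X c x) = c *\<^sub>R T x) \<and>
     (\<exists>K. \<forall>x\<in>ns_carrier X. norm (T x) \<le> K * ns_norm X x)"

definition weakly_compact_operator ::
    "'x nspace \<Rightarrow> ('x \<Rightarrow> 'e::real_normed_vector) \<Rightarrow> bool" where
  "weakly_compact_operator X T \<longleftrightarrow>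
     bounded_operator X T \<and> relatively_weakly_compact (T ` ns_ball X)"

definition disjointly_weakly_compact_operator ::
    "'x nspace \<Rightarrow> ('x \<Rightarrow> 'e::banach_lattice) \<Rightarrow> bool" where
  "disjointly_weakly_compact_operator X T \<longleftrightarrow>
     bounded_operator X T \<and> disjointly_weakly_compact (T ` ns_ball X)"

definition L_weakly_compact_operator ::
    "'x nspace \<Rightarrow> ('x \<Rightarrow> 'e::banach_lattice) \<Rightarrow> bool" where
  "L_weakly_compact_operator X T \<longleftrightarrow>
     bounded_operator X T \<and> L_weakly_compact (T ` ns_ball X)"

text \<open>Positivity refers to the coordinatewise order of the Banach lattice \<open>\<ell>\<^sub>1\<close>.\<close>

definition positive_on_ell1 :: "((nat \<Rightarrow> real) \<Rightarrow> 'e::banach_lattice) \<Rightarrow> bool" where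
  "positive_on_ell1 T \<longleftrightarrow> (\<forall>x\<in>ns_carrier ell1. (\<forall>n. 0 \<le> x n) \<longrightarrow> 0 \<le> T x)"

end

theory Submission
  imports Defs
begin

text \<open>The operator \<open>T\<close> on \<open>\<ell>\<^sub>1\<close> that sends the unit vectors to a positive weakly null sequence \<open>x\<close> is
  positive and weakly compact. If it is \<open>L\<close>-weakly compact, then every disjoint sequence lying below
  terms of \<open>x\<close> is norm null, and a disjointification argument in two stages gives \<open>x \<longlonglongrightarrow> 0\<close>: first
  \<open>inf (x i) (x n) \<longlonglongrightarrow> 0\<close> for fixed \<open>i\<close>, so that \<open>x\<close> is almost disjoint, then \<open>x\<close> itself. Conversely,
  the moduli of a disjoint sequence in a solid hull again form such a sequence, so the positive Schur
  property upgrades weak to norm convergence; that positive weakly compact operators on \<open>\<ell>\<^sub>1\<close> are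
  disjointly weakly compact follows by testing a weak cluster point against functionals carried by
  the ideals generated by the tails of the disjoint sequence.\<close>

section \<open>Vector lattice preliminaries\<close>

text \<open>In (3) implies (4), L-weak compactness controls disjoint sequences only, while the terms
  of \<open>x\<close> may overlap arbitrarily. Subtracting overlaps costs too much norm unless each
  fixed term already has norm null overlap with the later ones. That overlap lives in the order
  interval below \<open>x i\<close>, where norm null disjoint sequences make decreasing sequences
  converge, so that infinitely many subtractions have a limit.

  In (2) implies (3) the obstacle is that the solid hull of a weakly compact set need not be weakly
  compact. Positivity of the operator supplies a dominating sequence inside the image of the ball,
  and positive functionals carry the estimate over. Compactness enters as the finite intersection
  property, which yields a cluster point directly.

  (1) implies (2) is a matter of universes: l_1 has to be one of the spaces that (1) quantifies
  over.\<close>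

context lattice_ab_group_add
begin

text \<open>Raising an element by some \<open>d \<ge> 0\<close> raises its positive part by at most
  \<open>d\<close>. This is applied to the rises from \<open>m = inf a b\<close> to \<open>a\<close>
  and to \<open>b\<close>, whose infimum is 0.\<close>

lemma pprt_inf: "pprt (inf a b) = inf (pprt a) (pprt b)"
proof (rule order.antisym)
  define m where "m = inf a b"
  let ?t = "inf (pprt a) (pprt b)"
  have *: "pprt c \<le> pprt m + (c - m)" if "m \<le> c" for c
  proof -
    have "m + (c - m) \<le> pprt m + (c - m)"
      by (rule add_right_mono) (simp add: pprt_def)
    moreover have "0 \<le> pprt m + (c - m)"
      using that by (intro add_nonneg_nonneg zero_le_pprt) simp
    moreover have "m + (c - m) = c"
      by (simp add: add.commute[of m])
    ultimately show ?thesis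
      by (simp add: pprt_def[of c])
  qed
  have "?t \<le> pprt m + (a - m)"
    by (rule le_infI1[OF *]) (simp add: m_def)
  moreover have "?t \<le> pprt m + (b - m)"
    by (rule le_infI2[OF *]) (simp add: m_def)
  ultimately have "?t - pprt m \<le> inf (a - m) (b - m)"
    by (simp add: algebra_simps)
  also have "\<dots> = 0"
    using add_inf_distrib_right[of a b "- m", folded m_def] by simp
  finally show "?t \<le> pprt (inf a b)" by (simp add: m_def)
qed simp

lemma inf_add_le:
  assumes "0 \<le> a" "0 \<le> b" "0 \<le> c"
  shows "inf a (b + c) \<le> inf a b + inf a c"
proof -
  have "inf a (b + c) \<le> a + a" "inf a (b + c) \<le> a + c" "inf a (b + c) \<le> b + a"
    using assms by (auto intro: le_infI1 simp: add_increasing add_increasing2)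
  then show ?thesis
    by (simp add: add_inf_distrib_left add_inf_distrib_right)
qed

lemma inf_pprt_neg: "inf (pprt a) (pprt (- a)) = 0"
proof -
  have "inf (pprt a) (- nprt a) = - nprt a + inf (pprt a + nprt a) 0"
    unfolding add_inf_distrib_left by (simp add: algebra_simps)
  also have "\<dots> = - nprt a + nprt a"
    using prts[of a] by (simp add: nprt_def)
  finally show ?thesis by (simp add: pprt_neg)
qed

lemma disjoint_diff_inf: "inf (a - inf a b) (b - inf a b) = 0"
  unfolding diff_conv_add_uminus add_inf_distrib_right[symmetric] by (rule right_minus)

lemma disjoint_add_le:
  assumes "inf a b = 0" "a \<le> c" "b \<le> c"
  shows "a + b \<le> c"
  using assms add_eq_inf_sup[of a b] by simp

text \<open>The witness is the infimum of the \<open>a i\<close>, which \<open>pprt\<close>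
  preserves. A bound below positive parts is traded for one below the elements themselves, and the
  latter can be summed.\<close>

lemma le_pprt_common_lower_bound:
  assumes "finite F" "F \<noteq> {}" "\<And>i. i \<in> F \<Longrightarrow> t \<le> pprt (a i)"
  obtains b where "\<And>i. i \<in> F \<Longrightarrow> b \<le> a i" "t \<le> pprt b"
proof -
  have "\<exists>b. (\<forall>i\<in>F. b \<le> a i) \<and> t \<le> pprt b"
    using assms
  proof (induction F rule: finite_ne_induct)
    case (insert j F)
    then obtain b where b: "\<And>i. i \<in> F \<Longrightarrow> b \<le> a i" "t \<le> pprt b" by auto
    with insert show ?case
      by (intro exI[of _ "inf b (a j)"]) (auto simp: pprt_inf intro: le_infI1)
  qed auto
  with that show ?thesis by blast
qed

end

context lattice_ab_group_add_abs
begin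

lemma abs_inf_diff_le: "\<bar>inf x z - inf y z\<bar> \<le> \<bar>x - y\<bar>"
proof -
  have *: "inf x z - inf y z \<le> \<bar>x - y\<bar>" for x y
  proof -
    have "x - y \<le> \<bar>x - y\<bar>" by (rule abs_ge_self)
    then have "x \<le> y + \<bar>x - y\<bar>" by (simp add: diff_le_eq add.commute)
    then have "inf x z \<le> inf (y + \<bar>x - y\<bar>) (z + \<bar>x - y\<bar>)"
      by (auto intro: le_infI1 le_infI2 simp: add_increasing2 abs_ge_zero)
    then show ?thesis
      by (simp only: diff_le_eq add.commute flip: add_inf_distrib_right)
  qed
  show ?thesis
    by (intro abs_leI) (use *[of x y] *[of y x] in \<open>simp_all only: minus_diff_eq abs_minus_commute\<close>)
qed

text \<open>\<open>z1\<close> is \<open>z\<close> clipped to the interval from \<open>- y1\<close>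
  to \<open>y1\<close>; what clipping cuts off is at most \<open>y2\<close> in modulus.\<close>

lemma Riesz_decomposition:
  assumes z: "\<bar>z\<bar> \<le> y1 + y2" and "0 \<le> y1" "0 \<le> y2"
  obtains z1 z2 where "z = z1 + z2" "\<bar>z1\<bar> \<le> y1" "\<bar>z2\<bar> \<le> y2"
proof -
  define z1 where "z1 = inf (sup z (- y1)) y1"
  have le: "z \<le> y1 + y2" "- z \<le> y1 + y2" using z by (auto intro: order.trans[OF abs_ge_self] order.trans[OF abs_ge_minus_self])
  have y: "- y1 \<le> y1" using assms(2) by (rule order.trans[rotated]) (use assms(2) in simp)
  have "\<bar>z1\<bar> \<le> y1"
  proof (rule abs_leI)
    have "- y1 \<le> z1" using y by (simp add: z1_def)
    then show "- z1 \<le> y1" using minus_le_iff by blast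
  qed (simp add: z1_def)
  moreover have "\<bar>z - z1\<bar> \<le> y2"
  proof (rule abs_leI)
    have "z - y2 \<le> z1"
      unfolding z1_def
    proof (intro le_infI le_supI1)
      show "z - y2 \<le> z" using assms by (simp add: diff_le_eq)
      show "z - y2 \<le> y1" using le by (simp add: diff_le_eq)
    qed
    then show "z - z1 \<le> y2" by (simp add: algebra_simps)
    have "z1 \<le> sup z (- y1)" by (simp add: z1_def)
    also have "\<dots> \<le> z + y2"
    proof (rule le_supI)
      have "- y1 + (- z) \<le> - y1 + (y1 + y2)" using le(2) by (rule add_left_mono)
      then have "- y1 - z \<le> y2" by (simp add: add.assoc[symmetric])
      then show "- y1 \<le> z + y2" by (simp add: diff_le_eq add.commute)
    qed (use assms in simp)
    finally show "- (z - z1) \<le> y2" by (simp add: algebra_simps)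
  qed
  ultimately show ?thesis by (intro that[of z1 "z - z1"]) (simp_all add: add.commute[of z1])
qed

lemma disjoint_abs_add_le:
  assumes "inf \<bar>a\<bar> \<bar>b\<bar> = 0" "\<bar>a\<bar> \<le> c" "\<bar>b\<bar> \<le> c"
  shows "\<bar>a + b\<bar> \<le> c"
  using assms disjoint_add_le abs_triangle_ineq order.trans by blast

end

context
  fixes x y :: "'a::banach_lattice"
begin

lemma norm_abs_lattice: "norm \<bar>x\<bar> = norm x"
  by (intro antisym norm_lattice_mono) auto

lemma norm_mono_nonneg: "0 \<le> x \<Longrightarrow> x \<le> y \<Longrightarrow> norm x \<le> norm y"
  by (rule norm_lattice_mono) auto

lemma norm_pprt_le: "norm (pprt x) \<le> norm x"
  using norm_lattice_mono[of "pprt x" x] by (simp add: abs_prts)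

lemma scaleR_abs_le: "\<bar>c *\<^sub>R x\<bar> \<le> \<bar>c\<bar> *\<^sub>R \<bar>x\<bar>"
proof (cases "0 \<le> c")
  case True
  have "- (c *\<^sub>R x) = c *\<^sub>R (- x)" by simp
  also have "\<dots> \<le> c *\<^sub>R \<bar>x\<bar>" by (intro scaleR_left_mono True abs_ge_minus_self)
  finally show ?thesis
    using True by (intro abs_leI) (auto intro!: scaleR_left_mono abs_ge_self)
next
  case False
  have "c *\<^sub>R x = (- c) *\<^sub>R (- x)" by simp
  also have "\<dots> \<le> (- c) *\<^sub>R \<bar>x\<bar>" using False by (intro scaleR_left_mono abs_ge_minus_self) auto
  finally have 1: "c *\<^sub>R x \<le> (- c) *\<^sub>R \<bar>x\<bar>" .
  have "- (c *\<^sub>R x) = (- c) *\<^sub>R x" by simp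
  also have "\<dots> \<le> (- c) *\<^sub>R \<bar>x\<bar>" using False by (intro scaleR_left_mono abs_ge_self) auto
  finally show ?thesis using False 1 by (intro abs_leI) auto
qed

lemma disjoint_scaleR:
  assumes "inf x y = 0" "0 \<le> c" "0 \<le> d"
  shows "inf (c *\<^sub>R x) (d *\<^sub>R y) = 0"
proof (rule antisym)
  define e where "e = max c d + 1"
  have e: "e > 0" "c \<le> e" "d \<le> e" using assms by (auto simp: e_def)
  have xy: "0 \<le> x" "0 \<le> y" using assms(1) by (metis inf.cobounded1, metis inf.cobounded2)
  let ?t = "inf (c *\<^sub>R x) (d *\<^sub>R y)"
  have "?t \<le> e *\<^sub>R x" "?t \<le> e *\<^sub>R y"
    using e xy by (auto intro: le_infI1 le_infI2 scaleR_right_mono)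
  then have "(1/e) *\<^sub>R ?t \<le> (1/e) *\<^sub>R e *\<^sub>R x" "(1/e) *\<^sub>R ?t \<le> (1/e) *\<^sub>R e *\<^sub>R y"
    using e by (intro scaleR_left_mono; simp)+
  then have "(1/e) *\<^sub>R ?t \<le> inf x y" using e by simp
  then have "e *\<^sub>R (1/e) *\<^sub>R ?t \<le> e *\<^sub>R 0"
    unfolding assms(1) using e by (intro scaleR_left_mono) auto
  then show "?t \<le> 0" using e by simp
  show "0 \<le> ?t" using xy assms by (simp add: scaleR_nonneg_nonneg)
qed

end

section \<open>Compatibility of the order with norm limits and series\<close>

lemma tendsto_inf_const:
  fixes f :: "'b \<Rightarrow> 'a::banach_lattice"
  assumes "(f \<longlongrightarrow> l) F"
  shows "((\<lambda>n. inf (f n) z) \<longlongrightarrow> inf l z) F"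
proof (rule metric_tendsto_imp_tendsto[OF assms])
  show "\<forall>\<^sub>F n in F. dist (inf (f n) z) (inf l z) \<le> dist (f n) l"
    by (simp only: dist_norm norm_lattice_mono abs_inf_diff_le always_eventually simp_thms)
qed

text \<open>\<open>a \<le> l\<close> amounts to \<open>inf l a = a\<close>, and \<open>inf\<close>
  with a fixed element is norm continuous; this is the closedness of the positive cone.\<close>

lemma tendsto_lowerbound_lattice:
  fixes f :: "'b \<Rightarrow> 'a::banach_lattice"
  assumes "(f \<longlongrightarrow> l) F" "\<forall>\<^sub>F n in F. a \<le> f n" "F \<noteq> bot"
  shows "a \<le> l"
proof -
  have "((\<lambda>n. inf (f n) a) \<longlongrightarrow> a) F"
    by (rule tendsto_eventually) (use assms(2) in \<open>auto elim: eventually_mono simp: inf_absorb2\<close>)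
  with tendsto_inf_const[OF assms(1), of a] have "inf l a = a"
    using tendsto_unique assms(3) by blast
  then show ?thesis by (metis inf.cobounded1)
qed

lemma tendsto_upperbound_lattice:
  fixes f :: "'b \<Rightarrow> 'a::banach_lattice"
  assumes "(f \<longlongrightarrow> l) F" "\<forall>\<^sub>F n in F. f n \<le> a" "F \<noteq> bot"
  shows "l \<le> a"
  using tendsto_lowerbound_lattice[OF tendsto_minus[OF assms(1)], of "- a"] assms(2,3) by simp

lemma suminf_nonneg_lattice:
  fixes f :: "nat \<Rightarrow> 'a::banach_lattice"
  assumes "summable f" "\<And>n. 0 \<le> f n"
  shows "0 \<le> suminf f"
  by (rule tendsto_lowerbound_lattice[OF summable_LIMSEQ[OF assms(1)]])
    (use assms(2) in \<open>simp_all add: sum_nonneg\<close>)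

lemma term_le_suminf_lattice:
  fixes f :: "nat \<Rightarrow> 'a::banach_lattice"
  assumes "summable f" "\<And>n. 0 \<le> f n"
  shows "f k \<le> suminf f"
proof (rule tendsto_lowerbound_lattice[OF summable_LIMSEQ[OF assms(1)]])
  show "\<forall>\<^sub>F n in sequentially. f k \<le> sum f {..<n}"
    using eventually_gt_at_top[of k]
  proof eventually_elim
    case (elim n)
    then have "sum f {..<n} = f k + sum f ({..<n} - {k})"
      by (simp add: sum.remove)
    then show ?case using assms(2) by (simp add: sum_nonneg)
  qed
qed simp

section \<open>The Hahn--Banach theorem and positive functionals\<close>

definition sublinear :: "('a::real_vector \<Rightarrow> real) \<Rightarrow> bool" where
  "sublinear p \<longleftrightarrow> (\<forall>x y. p (x + y) \<le> p x + p y) \<and> (\<forall>c x. 0 \<le> c \<longrightarrow> p (c *\<^sub>R x) \<le> c * p x)"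

lemma sublinear_add: "sublinear p \<Longrightarrow> p (x + y) \<le> p x + p y"
  by (simp add: sublinear_def)

lemma sublinear_0: "sublinear p \<Longrightarrow> p 0 = 0"
  using sublinear_add[of p 0 0] by (auto simp: sublinear_def dest!: spec[of _ 0])

lemma sublinear_scaleR:
  assumes p: "sublinear p" and c: "0 \<le> c"
  shows "p (c *\<^sub>R x) = c * p x"
proof (cases "c = 0")
  case False
  then have "p x \<le> inverse c * p (c *\<^sub>R x)"
    using p c by (auto simp: sublinear_def dest!: spec[of _ "inverse c"] dest: spec[of _ "c *\<^sub>R x"])
  then have "c * p x \<le> p (c *\<^sub>R x)" using False c by (simp add: field_simps)
  then show ?thesis using p c by (auto simp: sublinear_def intro: antisym)
qed (simp add: sublinear_0 p)

lemma sublinear_ge: "sublinear p \<Longrightarrow> - p (- x) \<le> p x"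
  using sublinear_add[of p x "- x"] by (simp add: sublinear_0)

text \<open>Lowering a sublinear functional until it is linear in the direction \<open>x\<close>.\<close>

lemma sublinear_flatten:
  assumes p: "sublinear p"
  obtains q where "sublinear q" "\<And>y. q y \<le> p y" "q (- x) \<le> - p x"
proof -
  \<comment> \<open>A sublinear \<open>r \<le> p\<close> with \<open>r (- x) \<le> - p x\<close>
    satisfies \<open>r y \<le> r (y + t *\<^sub>R x) + t * r (- x)\<close>, hence lies below every
    element of \<open>S y\<close>. So the infimum is the largest candidate; \<open>t = 0\<close> and
    \<open>t = 1\<close> give its two bounds.\<close>
  define S where "S y = (\<lambda>t. p (y + t *\<^sub>R x) - t * p x) ` {0..}" for y
  define q where "q y = Inf (S y)" for y
  have bd: "bdd_below (S y)" for y
    unfolding S_def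
  proof (rule bdd_belowI2)
    fix t :: real assume "t \<in> {0..}"
    then have "t * p x = p ((y + t *\<^sub>R x) + (- y))" by (simp add: sublinear_scaleR p)
    also have "\<dots> \<le> p (y + t *\<^sub>R x) + p (- y)" by (rule sublinear_add[OF p])
    finally show "- p (- y) \<le> p (y + t *\<^sub>R x) - t * p x" by simp
  qed
  have ne: "S y \<noteq> {}" for y by (auto simp: S_def)
  have le: "q y \<le> p (y + t *\<^sub>R x) - t * p x" if "0 \<le> t" for y t
    unfolding q_def by (rule cInf_lower[OF _ bd]) (use that in \<open>auto simp: S_def\<close>)
  have "sublinear q"
    unfolding sublinear_def
  proof (intro conjI allI impI)
    fix y z
    have 1: "q (y + z) - a \<le> b" if "a \<in> S y" "b \<in> S z" for a b
    proof -
      from that obtain s t where st: "0 \<le> s" "0 \<le> t"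
        "a = p (y + s *\<^sub>R x) - s * p x" "b = p (z + t *\<^sub>R x) - t * p x"
        by (auto simp: S_def)
      have "q (y + z) \<le> p ((y + s *\<^sub>R x) + (z + t *\<^sub>R x)) - (s + t) * p x"
        using le[of "s + t" "y + z"] st by (simp add: algebra_simps)
      also have "\<dots> \<le> a + b"
        using sublinear_add[OF p, of "y + s *\<^sub>R x" "z + t *\<^sub>R x"] st by (simp add: algebra_simps)
      finally show ?thesis by simp
    qed
    have "q (y + z) - q z \<le> a" if "a \<in> S y" for a
    proof -
      have "q (y + z) - a \<le> q z"
        unfolding q_def[of z] using 1 that by (intro cInf_greatest ne) auto
      then show ?thesis by simp
    qed
    then have "q (y + z) - q z \<le> q y"
      unfolding q_def[of y] by (intro cInf_greatest ne) auto
    then show "q (y + z) \<le> q y + q z" by simp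
  next
    fix c y assume c: "0 \<le> (c::real)"
    show "q (c *\<^sub>R y) \<le> c * q y"
    proof (cases "c = 0")
      case True
      then show ?thesis using le[of 0 0] by (simp add: sublinear_0 p)
    next
      case False
      have "q (c *\<^sub>R y) / c \<le> q y"
        unfolding q_def[of y]
      proof (intro cInf_greatest ne)
        fix a assume "a \<in> S y"
        then obtain t where t: "0 \<le> t" "a = p (y + t *\<^sub>R x) - t * p x" by (auto simp: S_def)
        have "q (c *\<^sub>R y) \<le> p (c *\<^sub>R (y + t *\<^sub>R x)) - c * t * p x"
          using le[of "c * t" "c *\<^sub>R y"] c t by (simp add: algebra_simps)
        also have "\<dots> = c * a"
          unfolding sublinear_scaleR[OF p c] t(2) by (simp add: algebra_simps)
        finally show "q (c *\<^sub>R y) / c \<le> a" using False c by (simp add: field_simps)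
      qed
      then show ?thesis using False c by (simp add: field_simps)
    qed
  qed
  moreover have "q y \<le> p y" for y using le[of 0 y] by simp
  moreover have "q (- x) \<le> - p x" using le[of 1 "- x"] by (simp add: sublinear_0 p)
  ultimately show ?thesis by (rule that)
qed

text \<open>Subadditivity is where the chain matters: the members used at \<open>x\<close> and at
  \<open>y\<close> may both be replaced by the smaller of the two. A common lower bound at
  \<open>y\<close> is \<open>- p (- y)\<close>.\<close>

lemma sublinear_Inf_chain:
  assumes C: "C \<noteq> {}" "\<And>q. q \<in> C \<Longrightarrow> sublinear q" "\<And>q y. q \<in> C \<Longrightarrow> q y \<le> p y"
    and chain: "\<And>q r. q \<in> C \<Longrightarrow> r \<in> C \<Longrightarrow> q \<le> r \<or> r \<le> q"
  shows "sublinear (\<lambda>y. INF q\<in>C. q y)" "\<And>q y. q \<in> C \<Longrightarrow> (INF q\<in>C. q y) \<le> q y"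
proof -
  have bd: "bdd_below ((\<lambda>q. q y) ` C)" for y
  proof (rule bdd_belowI2)
    fix q assume "q \<in> C"
    with C(2,3)[of q] sublinear_ge[of q y] show "- p (- y) \<le> q y"
      by (metis neg_le_iff_le order_trans)
  qed
  show le: "(INF q\<in>C. q y) \<le> q y" if "q \<in> C" for q y
    by (rule cINF_lower[OF bd that])
  show "sublinear (\<lambda>y. INF q\<in>C. q y)"
    unfolding sublinear_def
  proof (intro conjI allI impI)
    fix x y
    have 1: "(INF q\<in>C. q (x + y)) - q x \<le> r y" if qr: "q \<in> C" "r \<in> C" for q r
    proof -
      obtain s where s: "s \<in> C" "s \<le> q" "s \<le> r"
        using chain[OF qr] qr by (cases "q \<le> r") auto
      have "(INF q\<in>C. q (x + y)) \<le> s x + s y"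
        by (rule order_trans[OF le[OF s(1)] sublinear_add[OF C(2)[OF s(1)]]])
      moreover have "s x \<le> q x" "s y \<le> r y" using s(2,3) by (auto dest: le_funD)
      ultimately show ?thesis by linarith
    qed
    have "(INF q\<in>C. q (x + y)) - (INF q\<in>C. q y) \<le> q x" if "q \<in> C" for q
    proof -
      have "(INF q\<in>C. q (x + y)) - q x \<le> (INF q\<in>C. q y)"
        using 1 that C(1) by (intro cINF_greatest) auto
      then show ?thesis by simp
    qed
    then have "(INF q\<in>C. q (x + y)) - (INF q\<in>C. q y) \<le> (INF q\<in>C. q x)"
      using C(1) by (intro cINF_greatest) auto
    then show "(INF q\<in>C. q (x + y)) \<le> (INF q\<in>C. q x) + (INF q\<in>C. q y)" by simp
  next
    fix c x assume c: "0 \<le> (c::real)"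
    show "(INF q\<in>C. q (c *\<^sub>R x)) \<le> c * (INF q\<in>C. q x)"
    proof (cases "c = 0")
      case True
      obtain q where "q \<in> C" using C by auto
      then show ?thesis using le[of q 0] True C(2) by (simp add: sublinear_0)
    next
      case False
      have "(INF q\<in>C. q (c *\<^sub>R x)) / c \<le> (INF q\<in>C. q x)"
      proof (intro cINF_greatest C(1))
        fix q assume "q \<in> C"
        then have "(INF q\<in>C. q (c *\<^sub>R x)) \<le> c * q x"
          using le[of q "c *\<^sub>R x"] C(2) c by (simp add: sublinear_scaleR)
        then show "(INF q\<in>C. q (c *\<^sub>R x)) / c \<le> q x"
          using False c by (simp add: field_simps)
      qed
      then show ?thesis using False c by (simp add: field_simps)
    qed
  qed
qed

text \<open>Linear functionals are the minimal sublinear ones: a minimal \<open>f\<close> cannot be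
  lowered by flattening it in any direction, so it is odd, and odd sublinear functionals are linear.
  Flattening \<open>p\<close> in direction \<open>x\<close> before applying Zorn's lemma pins down
  \<open>f x = p x\<close>.\<close>

theorem Hahn_Banach_sublinear:
  fixes p :: "'a::real_vector \<Rightarrow> real"
  assumes p: "sublinear p"
  obtains f where "linear f" "\<And>y. f y \<le> p y" "f x = p x"
proof -
  from sublinear_flatten[OF p] obtain p' where
    p': "sublinear p'" "\<And>y. p' y \<le> p y" "p' (- x) \<le> - p x" by metis
  define A where "A = {q. sublinear q \<and> q \<le> p'}"
  have "\<exists>m\<in>A. \<forall>a\<in>A. m \<ge> a \<longrightarrow> a = m"
  proof (rule predicate_Zorn)
    show "partial_order_on A (relation_of (\<ge>) A)"
      by (rule partial_order_on_relation_ofI) auto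
    fix C assume C: "C \<in> Chains (relation_of (\<ge>) A)"
    show "\<exists>u\<in>A. \<forall>a\<in>C. u \<le> a"
    proof (cases "C = {}")
      case True
      then show ?thesis using p' by (auto simp: A_def)
    next
      case False
      have sub: "C \<subseteq> A" and chain: "\<And>q r. q \<in> C \<Longrightarrow> r \<in> C \<Longrightarrow> q \<le> r \<or> r \<le> q"
        using C by (auto simp: Chains_def relation_of_def)
      note inf = sublinear_Inf_chain[of C p', OF False _ _ chain]
      define u where "u = (\<lambda>y. INF q\<in>C. q y)"
      have 1: "sublinear u"
        unfolding u_def by (rule inf) (use sub in \<open>auto simp: A_def le_fun_def\<close>)
      have 2: "u \<le> q" if "q \<in> C" for q
        unfolding u_def le_fun_def by (intro allI inf) (use sub that in \<open>auto simp: A_def le_fun_def\<close>)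
      obtain q where "q \<in> C" using False by auto
      then have "u \<le> p'" using 2 sub by (auto simp: A_def intro: order_trans)
      with 1 2 show ?thesis by (auto simp: A_def)
    qed
  qed
  then obtain f where f: "sublinear f" "f \<le> p'" and
    min: "\<And>q. sublinear q \<Longrightarrow> q \<le> f \<Longrightarrow> q = f"
    by (auto simp: A_def intro: order_trans)
  have odd: "f (- y) = - f y" for y
  proof -
    from sublinear_flatten[OF f(1)] obtain q where
      q: "sublinear q" "\<And>z. q z \<le> f z" "q (- y) \<le> - f y" by metis
    then have "q = f" by (intro min) (auto simp: le_fun_def)
    then show ?thesis using q sublinear_ge[OF f(1), of "- y"] by simp
  qed
  have "linear f"
  proof
    show "f (y + z) = f y + f z" for y z
      using sublinear_add[OF f(1), of y z] sublinear_add[OF f(1), of "y + z" "- z"]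
      by (simp add: odd)
    show "f (c *\<^sub>R y) = c *\<^sub>R f y" for c y
    proof (cases "0 \<le> c")
      case False
      then show ?thesis
        using sublinear_scaleR[OF f(1), of "- c" y] by (simp add: odd)
    qed (simp add: sublinear_scaleR f)
  qed
  moreover have "f y \<le> p y" for y
    using f(2) p'(2)[of y] by (auto simp: le_fun_def intro: order_trans)
  moreover have "p x \<le> f x"
    using f(2) p'(3) odd[of x] by (auto simp: le_fun_def dest!: spec[of _ "- x"])
  ultimately show ?thesis by (intro that[of f]) (auto intro: antisym)
qed

lemma norming_functional:
  fixes x :: "'a::real_normed_vector"
  obtains f :: "'a \<Rightarrow>\<^sub>L real" where "f x = norm x"
proof -
  have "sublinear (norm :: 'a \<Rightarrow> real)"
    by (auto simp: sublinear_def norm_triangle_ineq)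
  then obtain f :: "'a \<Rightarrow> real" where f: "linear f" "\<And>y. f y \<le> norm y" "f x = norm x"
    using Hahn_Banach_sublinear by blast
  have "bounded_linear f"
  proof (rule bounded_linear_intro[of _ 1])
    show "norm (f y) \<le> norm y * 1" for y
      using f(2)[of y] f(2)[of "- y"] linear_neg[OF f(1)] by (auto simp: abs_if)
  qed (use f(1) in \<open>auto simp: linear_iff\<close>)
  then show ?thesis
    using f(3) by (intro that[of "Blinfun f"]) (simp add: bounded_linear_Blinfun_apply)
qed

text \<open>Dominating by the norm of the positive part forces positivity: this sublinear functional
  vanishes at \<open>- y\<close> for \<open>y \<ge> 0\<close>, and at \<open>x\<close> it still has
  the value \<open>norm x\<close>.\<close>

lemma positive_norming_functional:
  fixes x :: "'a::banach_lattice"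
  assumes x: "0 \<le> x"
  obtains f :: "'a \<Rightarrow>\<^sub>L real" where "f x = norm x" "\<And>y. 0 \<le> y \<Longrightarrow> 0 \<le> f y" "\<And>y. \<bar>f y\<bar> \<le> norm y"
proof -
  have "sublinear (\<lambda>y::'a. norm (pprt y))"
    unfolding sublinear_def
  proof (intro conjI allI impI)
    fix y z :: 'a
    have "y \<le> pprt y" "z \<le> pprt z" by (simp_all add: pprt_def)
    then have "pprt (y + z) \<le> pprt y + pprt z"
      by (simp add: pprt_def[of "y + z"] add_mono)
    then have "norm (pprt (y + z)) \<le> norm (pprt y + pprt z)"
      by (intro norm_mono_nonneg) auto
    then show "norm (pprt (y + z)) \<le> norm (pprt y) + norm (pprt z)"
      using norm_triangle_ineq order_trans by blast
    fix c :: real assume c: "0 \<le> c"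
    have "pprt (c *\<^sub>R y) \<le> c *\<^sub>R pprt y"
      using c \<open>y \<le> pprt y\<close>
      by (simp add: pprt_def[of "c *\<^sub>R y"] scaleR_left_mono scaleR_nonneg_nonneg)
    then have "norm (pprt (c *\<^sub>R y)) \<le> norm (c *\<^sub>R pprt y)"
      by (intro norm_mono_nonneg) auto
    then show "norm (pprt (c *\<^sub>R y)) \<le> c * norm (pprt y)" using c by simp
  qed
  then obtain f :: "'a \<Rightarrow> real" where
    f: "linear f" "\<And>y. f y \<le> norm (pprt y)" "f x = norm (pprt x)"
    using Hahn_Banach_sublinear by blast
  have abs: "\<bar>f y\<bar> \<le> norm y" for y
    using f(2)[of y] f(2)[of "- y"] linear_neg[OF f(1), of y] norm_pprt_le[of y] norm_pprt_le[of "- y"]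
    by (auto simp: abs_if)
  have "bounded_linear f"
    by (rule bounded_linear_intro[of _ 1]) (use f(1) abs in \<open>auto simp: linear_iff\<close>)
  moreover have "0 \<le> f y" if "0 \<le> y" for y
    using f(2)[of "- y"] that linear_neg[OF f(1), of y] by simp
  ultimately show ?thesis
    using f(3) x abs by (intro that[of "Blinfun f"]) (simp_all add: bounded_linear_Blinfun_apply)
qed

section \<open>Weak topology\<close>

lemma topspace_weak_topology [simp]:
  "topspace (weak_topology :: 'a::real_normed_vector topology) = UNIV"
proof -
  have "UNIV \<in> {blinfun_apply f -` U | (f :: 'a \<Rightarrow>\<^sub>L real) U. open U}"
    by (auto intro!: exI[of _ 0] exI[of _ UNIV])
  then show ?thesis
    unfolding weak_topology_def topology_generated_by_topspace by blast
qed

lemma openin_weak_vimage: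
  fixes f :: "'a::real_normed_vector \<Rightarrow>\<^sub>L real"
  shows "open U \<Longrightarrow> openin weak_topology (blinfun_apply f -` U)"
  unfolding weak_topology_def by (rule topology_generated_by_Basis) auto

lemma weakly_null_iff:
  fixes x :: "nat \<Rightarrow> 'a::real_normed_vector"
  shows "weakly_null x \<longleftrightarrow> (\<forall>f :: 'a \<Rightarrow>\<^sub>L real. (\<lambda>n. f (x n)) \<longlonglongrightarrow> 0)"
proof (intro iffI allI)
  fix f :: "'a \<Rightarrow>\<^sub>L real" assume x: "weakly_null x"
  show "(\<lambda>n. blinfun_apply f (x n)) \<longlonglongrightarrow> 0"
  proof (rule topological_tendstoI)
    fix U :: "real set" assume "open U" "0 \<in> U"
    then show "\<forall>\<^sub>F n in sequentially. blinfun_apply f (x n) \<in> U"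
      using x openin_weak_vimage[of U f] by (force simp: weakly_null_def limitin_def)
  qed
next
  assume x: "\<forall>f :: 'a \<Rightarrow>\<^sub>L real. (\<lambda>n. f (x n)) \<longlonglongrightarrow> 0"
  have "\<forall>\<^sub>F n in sequentially. x n \<in> V"
    if "generate_topology_on {blinfun_apply f -` U | (f :: 'a \<Rightarrow>\<^sub>L real) U. open U} V" "0 \<in> V" for V
    using that
  proof induction
    case (Basis V)
    then obtain f and U :: "real set" where fU: "V = blinfun_apply f -` U" "open U" by auto
    then show ?case
      using topological_tendstoD[OF x[rule_format, of f] fU(2)] Basis by simp
  next
    case (UN K)
    then obtain k where "k \<in> K" "0 \<in> k" by auto
    then show ?case by (rule eventually_mono[OF UN.IH]) (use \<open>k \<in> K\<close> in auto)
  qed (auto intro: eventually_conj)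
  then have "\<forall>\<^sub>F n in sequentially. x n \<in> V" if "openin weak_topology V" "0 \<in> V" for V
    using that by (simp add: weak_topology_def openin_topology_generated_by_iff)
  then show "weakly_null x"
    by (simp add: weakly_null_def limitin_def)
qed

text \<open>Norming functionals separate points. As a consequence, a weakly compact image of the
  ball equals its own weak closure.\<close>

lemma Hausdorff_weak_topology: "Hausdorff_space (weak_topology :: 'a::real_normed_vector topology)"
  unfolding Hausdorff_space_def
proof (intro allI impI, elim conjE)
  fix x y :: 'a assume "x \<noteq> y"
  obtain f :: "'a \<Rightarrow>\<^sub>L real" where "f (x - y) = norm (x - y)" by (rule norming_functional)
  with \<open>x \<noteq> y\<close> have "f x \<noteq> f y" by (auto simp: blinfun.diff_right)
  from hausdorff[OF this] obtain U V where UV: "open U" "open V" "f x \<in> U" "f y \<in> V" "U \<inter> V = {}"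
    by auto
  show "\<exists>U V. openin weak_topology U \<and> openin weak_topology V \<and> x \<in> U \<and> y \<in> V \<and> disjnt U V"
    using UV openin_weak_vimage[of U f] openin_weak_vimage[of V f]
    by (intro exI[of _ "blinfun_apply f -` U"] exI[of _ "blinfun_apply f -` V"]) (auto simp: disjnt_def)
qed

section \<open>Functionals carried by an ideal\<close>

text \<open>The modulus of the restriction of \<open>f\<close> to the ideal \<open>I\<close>, extended by \<open>0\<close> to the disjoint
  complement of \<open>I\<close>.\<close>

lemma ideal_functional:
  fixes f :: "'a::banach_lattice \<Rightarrow>\<^sub>L real"
  assumes sub: "subspace I" and solid: "\<And>w z. z \<in> I \<Longrightarrow> \<bar>w\<bar> \<le> \<bar>z\<bar> \<Longrightarrow> w \<in> I"
  obtains g :: "'a \<Rightarrow>\<^sub>L real" where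
    "\<And>y. 0 \<le> y \<Longrightarrow> g y = (SUP z\<in>{z\<in>I. \<bar>z\<bar> \<le> y}. f z)"
    "\<And>y z. z \<in> I \<Longrightarrow> \<bar>z\<bar> \<le> y \<Longrightarrow> f z \<le> g y"
proof -
  define A where "A y = {z\<in>I. \<bar>z\<bar> \<le> y}" for y
  define s where "s y = (SUP z\<in>A y. f z)" for y
  have f_le: "f z \<le> norm f * norm y" if "z \<in> A y" for y z
  proof -
    have "norm z \<le> norm y"
      using that by (intro norm_lattice_mono) (auto simp: A_def intro: order_trans[OF _ abs_ge_self])
    then show ?thesis
      using norm_blinfun[of f z] mult_left_mono[of "norm z" "norm y" "norm f"] by (auto simp: abs_le_iff)
  qed
  then have bd: "bdd_above (blinfun_apply f ` A y)" for y by (intro bdd_aboveI2)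
  have 0: "0 \<in> A y" if "0 \<le> y" for y using that sub by (auto simp: A_def subspace_0)
  have le: "f z \<le> s y" if "z \<in> A y" for y z unfolding s_def by (rule cSUP_upper[OF that bd])
  have s_nonneg: "0 \<le> s y" if "0 \<le> y" for y using le[OF 0[OF that]] by simp
  have s_le: "s y \<le> norm f * norm y" if "0 \<le> y" for y
    unfolding s_def by (rule cSUP_least) (use 0[OF that] f_le in auto)
  have s_add: "s (y + z) = s y + s z" if y: "0 \<le> y" and z: "0 \<le> z" for y z
  proof (rule antisym)
    have yz: "0 \<le> y + z" using y z by simp
    show "s (y + z) \<le> s y + s z"
      unfolding s_def[of "y + z"]
    proof (rule cSUP_least)
      fix w assume "w \<in> A (y + z)"
      then have w: "w \<in> I" "\<bar>w\<bar> \<le> y + z" by (auto simp: A_def)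
      \<comment> \<open>Decomposing along \<open>inf y \<bar>w\<bar>\<close> instead of
        \<open>y\<close> keeps \<open>\<bar>w1\<bar> \<le> \<bar>w\<bar>\<close>; solidity then puts
        \<open>w1\<close>, and with it \<open>w2\<close>, into \<open>I\<close>.\<close>
      obtain w1 w2 where d: "w = w1 + w2" "\<bar>w1\<bar> \<le> y" "\<bar>w2\<bar> \<le> z" "\<bar>w1\<bar> \<le> \<bar>w\<bar>"
      proof -
        obtain w1 w2 where d: "w = w1 + w2" "\<bar>w1\<bar> \<le> inf y \<bar>w\<bar>" "\<bar>w2\<bar> \<le> z"
        proof (rule Riesz_decomposition[of w "inf y \<bar>w\<bar>" z])
          have "\<bar>w\<bar> - z \<le> y" using w by (simp add: algebra_simps)
          moreover have "\<bar>w\<bar> - z \<le> \<bar>w\<bar>" using z by (simp add: algebra_simps)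
          ultimately have "\<bar>w\<bar> - z \<le> inf y \<bar>w\<bar>" by simp
          then show "\<bar>w\<bar> \<le> inf y \<bar>w\<bar> + z" by (simp only: diff_le_eq)
        qed (use y z in auto)
        then show ?thesis by (intro that) auto
      qed
      have w1: "w1 \<in> I" using solid[OF w(1)] d by simp
      have "w2 = w - w1" using d by simp
      then have "w2 \<in> I" using subspace_diff[OF sub w(1) w1] by simp
      with w1 d show "f w \<le> s y + s z"
        using le[of w1 y] le[of w2 z] by (simp add: A_def blinfun.add_right)
    qed (use 0[OF yz] in auto)
    have 1: "f v + f w \<le> s (y + z)" if "v \<in> A y" "w \<in> A z" for v w
    proof -
      have "v + w \<in> A (y + z)"
        using that sub by (auto simp: A_def subspace_add intro: order_trans[OF abs_triangle_ineq] add_mono)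
      from le[OF this] show ?thesis by (simp add: blinfun.add_right)
    qed
    have "s y \<le> s (y + z) - f w" if w: "w \<in> A z" for w
      unfolding s_def[of y] by (rule cSUP_least) (use 0[OF y] 1[OF _ w] in \<open>force simp: algebra_simps\<close>)+
    then have "s z \<le> s (y + z) - s y"
      unfolding s_def[of z] by (intro cSUP_least) (use 0[OF z] in \<open>force simp: algebra_simps\<close>)+
    then show "s y + s z \<le> s (y + z)" by simp
  qed
  have s_scale_le: "c * s y \<le> s (c *\<^sub>R y)" if c: "0 < c" and y: "0 \<le> y" for c y
  proof -
    have "s y \<le> s (c *\<^sub>R y) / c"
      unfolding s_def[of y]
    proof (rule cSUP_least)
      fix z assume z: "z \<in> A y"
      have "\<bar>c *\<^sub>R z\<bar> \<le> c *\<^sub>R \<bar>z\<bar>" using scaleR_abs_le[of c z] c by simp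
      also have "\<dots> \<le> c *\<^sub>R y" using z c by (intro scaleR_left_mono) (auto simp: A_def)
      finally have "c *\<^sub>R z \<in> A (c *\<^sub>R y)" using z sub by (simp add: A_def subspace_scale)
      from le[OF this] show "f z \<le> s (c *\<^sub>R y) / c" using c by (simp add: blinfun.scaleR_right field_simps)
    qed (use 0[OF y] in auto)
    then show ?thesis using c by (simp add: field_simps)
  qed
  have s_scale: "s (c *\<^sub>R y) = c * s y" if c: "0 < c" and y: "0 \<le> y" for c y
  proof (rule antisym)
    have "inverse c * s (c *\<^sub>R y) \<le> s y"
      using s_scale_le[of "inverse c" "c *\<^sub>R y"] c y by (simp add: scaleR_nonneg_nonneg)
    then show "s (c *\<^sub>R y) \<le> c * s y" using c by (simp add: field_simps)
  qed (rule s_scale_le[OF c y])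
  define g where "g y = s (pprt y) - s (pprt (- y))" for y
  have dec: "y = pprt y - pprt (- y)" for y :: 'a using prts[of y] by (simp add: pprt_neg)
  \<comment> \<open>Since \<open>s\<close> is additive on the cone, every representation of
    \<open>y\<close> as a difference of positive elements gives the same value. Linearity of
    \<open>g\<close> becomes a matter of choosing convenient representations.\<close>
  have g_diff: "g y = s a - s b" if "0 \<le> a" "0 \<le> b" "y = a - b" for y a b
  proof -
    have "pprt y - pprt (- y) = a - b"
      using dec[of y] that(3) by simp
    then have "pprt y + b = a + pprt (- y)" by (simp add: algebra_simps)
    then have "s (pprt y) + s b = s a + s (pprt (- y))"
      using s_add[of "pprt y" b] s_add[of a "pprt (- y)"] that by simp
    then show ?thesis by (simp add: g_def)
  qed
  have s0: "s 0 = 0" using s_add[of 0 0] by simp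
  have g_pos: "g y = s y" if "0 \<le> y" for y using g_diff[of y 0 y] that s0 by simp
  have g_neg: "g (- y) = - g y" for y by (simp add: g_def)
  have g_scale_pos: "g (c *\<^sub>R y) = c * g y" if "0 < c" for c y
  proof -
    have "g (c *\<^sub>R y) = s (c *\<^sub>R pprt y) - s (c *\<^sub>R pprt (- y))"
      using that dec[of y] by (intro g_diff) (auto simp: scaleR_nonneg_nonneg simp flip: scaleR_diff_right)
    then show ?thesis using that by (simp add: s_scale g_def algebra_simps)
  qed
  have "bounded_linear g"
  proof (rule bounded_linear_intro[of _ "2 * norm f"])
    fix y z
    have "g (y + z) = s (pprt y + pprt z) - s (pprt (- y) + pprt (- z))"
      by (intro g_diff) (simp_all only: add_diff_add flip: dec, simp_all)
    then show "g (y + z) = g y + g z" by (simp add: s_add g_def)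
  next
    fix c :: real and y
    consider "c = 0" | "c > 0" | "- c > 0" by linarith
    then show "g (c *\<^sub>R y) = c *\<^sub>R g y"
    proof cases
      case 3
      then show ?thesis using g_scale_pos[of "- c" y] g_neg[of "c *\<^sub>R y"] by simp
    qed (auto simp: g_scale_pos g_pos s0)
  next
    fix y
    have "s (pprt y) \<le> norm f * norm y" "s (pprt (- y)) \<le> norm f * norm y"
      using norm_pprt_le[of y] norm_pprt_le[of "- y"]
      by (auto intro!: order_trans[OF s_le] mult_left_mono)
    then show "norm (g y) \<le> norm y * (2 * norm f)"
      using s_nonneg[of "pprt y"] s_nonneg[of "pprt (- y)"] unfolding g_def real_norm_def
      by (auto simp: abs_le_iff mult.commute)
  qed
  then show ?thesis
    using le by (intro that[of "Blinfun g"])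
      (auto simp: bounded_linear_Blinfun_apply g_pos s_def A_def order_trans[OF abs_ge_zero])
qed

section \<open>Relatively weakly compact sets\<close>

text \<open>The order ideal generated by the \<open>x n\<close> with \<open>n \<ge> N\<close>. A
  single \<open>k\<close> bounds both the multiple and the indices, as either may be enlarged; if
  \<open>x\<close> is disjoint, an element with bound \<open>k\<close> is disjoint from
  \<open>tail_ideal x k\<close>.\<close>

definition tail_ideal :: "(nat \<Rightarrow> 'a::banach_lattice) \<Rightarrow> nat \<Rightarrow> 'a set" where
  "tail_ideal x N = {z. \<exists>k. \<bar>z\<bar> \<le> real k *\<^sub>R (\<Sum>n\<in>{N..<k}. \<bar>x n\<bar>)}"

lemma tail_ideal_mono_bound:
  fixes x :: "nat \<Rightarrow> 'a::banach_lattice"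
  assumes "k \<le> l" "M \<le> N"
  shows "real k *\<^sub>R (\<Sum>n\<in>{N..<k}. \<bar>x n\<bar>) \<le> real l *\<^sub>R (\<Sum>n\<in>{M..<l}. \<bar>x n\<bar>)"
proof -
  have "(\<Sum>n\<in>{N..<k}. \<bar>x n\<bar>) \<le> (\<Sum>n\<in>{M..<l}. \<bar>x n\<bar>)"
    using assms by (intro sum_mono2) auto
  then show ?thesis
    using assms by (intro scaleR_mono) (auto intro: sum_nonneg)
qed

lemma tail_ideal_antimono: "M \<le> N \<Longrightarrow> tail_ideal x N \<subseteq> tail_ideal x M"
  unfolding tail_ideal_def using tail_ideal_mono_bound[of _ _ M N x] order_trans by blast

lemma tail_ideal_solid: "z \<in> tail_ideal x N \<Longrightarrow> \<bar>w\<bar> \<le> \<bar>z\<bar> \<Longrightarrow> w \<in> tail_ideal x N"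
  unfolding tail_ideal_def using order_trans by blast

lemma subspace_tail_ideal: "subspace (tail_ideal x N)"
proof (rule subspaceI)
  show "0 \<in> tail_ideal x N" by (auto simp: tail_ideal_def intro: exI[of _ 0])
  fix y z assume "y \<in> tail_ideal x N" "z \<in> tail_ideal x N"
  then obtain k l where kl: "\<bar>y\<bar> \<le> real k *\<^sub>R (\<Sum>n\<in>{N..<k}. \<bar>x n\<bar>)" "\<bar>z\<bar> \<le> real l *\<^sub>R (\<Sum>n\<in>{N..<l}. \<bar>x n\<bar>)"
    by (auto simp: tail_ideal_def)
  have "\<bar>y + z\<bar> \<le> real k *\<^sub>R (\<Sum>n\<in>{N..<k}. \<bar>x n\<bar>) + real l *\<^sub>R (\<Sum>n\<in>{N..<l}. \<bar>x n\<bar>)"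
    using abs_triangle_ineq add_mono[OF kl] order_trans by blast
  also have "\<dots> \<le> real k *\<^sub>R (\<Sum>n\<in>{N..<k+l}. \<bar>x n\<bar>) + real l *\<^sub>R (\<Sum>n\<in>{N..<k+l}. \<bar>x n\<bar>)"
    by (intro add_mono scaleR_left_mono sum_mono2) auto
  also have "\<dots> = real (k + l) *\<^sub>R (\<Sum>n\<in>{N..<k+l}. \<bar>x n\<bar>)" by (simp add: scaleR_left_distrib)
  finally show "y + z \<in> tail_ideal x N" unfolding tail_ideal_def by blast
next
  fix c z assume "z \<in> tail_ideal x N"
  then obtain k where k: "\<bar>z\<bar> \<le> real k *\<^sub>R (\<Sum>n\<in>{N..<k}. \<bar>x n\<bar>)" by (auto simp: tail_ideal_def)
  \<comment> \<open>\<open>1 \<le> m\<close> gives \<open>k \<le> m * k\<close>, so the index range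
    does not shrink when \<open>c\<close> is small.\<close>
  obtain m :: nat where m: "\<bar>c\<bar> \<le> real m" "1 \<le> m"
    by (meson le_trans linorder_le_cases of_nat_le_iff order_trans real_arch_simple)
  have "\<bar>c *\<^sub>R z\<bar> \<le> \<bar>c\<bar> *\<^sub>R \<bar>z\<bar>" by (rule scaleR_abs_le)
  also have "\<dots> \<le> real m *\<^sub>R (real k *\<^sub>R (\<Sum>n\<in>{N..<k}. \<bar>x n\<bar>))"
    using m k by (intro scaleR_mono) auto
  also have "\<dots> \<le> real (m * k) *\<^sub>R (\<Sum>n\<in>{N..<m * k}. \<bar>x n\<bar>)"
    unfolding scaleR_scaleR of_nat_mult[symmetric]
    using m by (intro scaleR_left_mono sum_mono2) (auto intro: less_le_trans)
  finally show "c *\<^sub>R z \<in> tail_ideal x N" unfolding tail_ideal_def by blast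
qed

lemma disjoint_sum_right:
  fixes a :: "'a::banach_lattice"
  assumes "0 \<le> a" "\<And>i. i \<in> F \<Longrightarrow> 0 \<le> b i" "\<And>i. i \<in> F \<Longrightarrow> inf a (b i) = 0"
  shows "inf a (\<Sum>i\<in>F. b i) = 0"
  using assms
proof (induction F rule: infinite_finite_induct)
  case (insert i F)
  have "inf a (b i + (\<Sum>i\<in>F. b i)) \<le> inf a (b i) + inf a (\<Sum>i\<in>F. b i)"
    using insert.prems by (intro inf_add_le sum_nonneg) auto
  with insert show ?case by (auto intro!: antisym simp: sum_nonneg)
qed (auto simp: inf_absorb2)

lemma disjoint_tails:
  fixes x :: "nat \<Rightarrow> 'a::banach_lattice"
  assumes x: "disjoint_seq x" and k: "\<bar>z\<bar> \<le> real k *\<^sub>R (\<Sum>n\<in>{M..<k}. \<bar>x n\<bar>)" and w: "w \<in> tail_ideal x k"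
  shows "inf \<bar>z\<bar> \<bar>w\<bar> = 0"
proof (rule antisym)
  obtain l where l: "\<bar>w\<bar> \<le> real l *\<^sub>R (\<Sum>n\<in>{k..<l}. \<bar>x n\<bar>)" using w by (auto simp: tail_ideal_def)
  have "inf \<bar>x n\<bar> (\<Sum>m\<in>{M..<k}. \<bar>x m\<bar>) = 0" if "n \<in> {k..<l}" for n
    using x that by (intro disjoint_sum_right) (auto simp: disjoint_seq_def)
  then have "inf (\<Sum>m\<in>{M..<k}. \<bar>x m\<bar>) (\<Sum>n\<in>{k..<l}. \<bar>x n\<bar>) = 0"
    by (intro disjoint_sum_right) (auto simp: inf_commute intro: sum_nonneg)
  from disjoint_scaleR[OF this, of "real k" "real l"]
  show "inf \<bar>z\<bar> \<bar>w\<bar> \<le> 0" using inf_mono[OF k l] by simp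
qed simp

text \<open>If \<open>d > 0\<close>, elements with \<open>f\<close>-value at least \<open>d\<close>
  could be picked one after another, each from a tail disjoint from the earlier ones. Disjoint
  elements of modulus below \<open>y\<close> add up to one still below \<open>y\<close>, while the
  values of \<open>f\<close> accumulate beyond \<open>norm f * norm y\<close>.\<close>

lemma disjoint_functional_bound:
  fixes x :: "nat \<Rightarrow> 'a::banach_lattice" and f :: "'a \<Rightarrow>\<^sub>L real"
  assumes x: "disjoint_seq x" and y: "0 \<le> y" and d: "\<And>N. \<exists>z \<in> tail_ideal x N. \<bar>z\<bar> \<le> y \<and> d \<le> f z"
  shows "d \<le> 0"
proof (rule ccontr)
  assume "\<not> d \<le> 0"
  have "\<exists>z \<in> tail_ideal x 0. \<bar>z\<bar> \<le> y \<and> real m * d \<le> f z" for m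
  proof (induction m)
    case 0
    show ?case using y by (intro bexI[of _ 0]) (auto intro: subspace_0 subspace_tail_ideal)
  next
    case (Suc m)
    then obtain z where z: "z \<in> tail_ideal x 0" "\<bar>z\<bar> \<le> y" "real m * d \<le> f z" by blast
    then obtain k where k: "\<bar>z\<bar> \<le> real k *\<^sub>R (\<Sum>n\<in>{0..<k}. \<bar>x n\<bar>)" by (auto simp: tail_ideal_def)
    obtain w where w: "w \<in> tail_ideal x k" "\<bar>w\<bar> \<le> y" "d \<le> f w" using d by blast
    have "z + w \<in> tail_ideal x 0"
      using z w tail_ideal_antimono[of 0 k x] by (intro subspace_add subspace_tail_ideal) auto
    moreover have "\<bar>z + w\<bar> \<le> y"
      using disjoint_tails[OF x k w(1)] z w by (intro disjoint_abs_add_le) auto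
    ultimately show ?case
      using z w by (intro bexI[of _ "z + w"]) (auto simp: blinfun.add_right algebra_simps)
  qed
  then have "real m * d \<le> norm f * norm y" for m
  proof -
    assume "\<And>m. \<exists>z\<in>tail_ideal x 0. \<bar>z\<bar> \<le> y \<and> real m * d \<le> f z"
    then obtain z where z: "\<bar>z\<bar> \<le> y" "real m * d \<le> f z" by blast
    have "norm z \<le> norm y"
      using z by (intro norm_lattice_mono) (auto intro: order_trans[OF _ abs_ge_self])
    then show ?thesis
      using z norm_blinfun[of f z] mult_left_mono[of "norm z" "norm y" "norm f"] by (auto simp: abs_le_iff)
  qed
  moreover obtain m :: nat where "norm f * norm y < real m * d"
    using reals_Archimedean3[of d] \<open>\<not> d \<le> 0\<close> by auto
  ultimately show False using not_le by blast
qed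

text \<open>If \<open>f (x n)\<close> does not tend to \<open>0\<close>, the functionals \<open>g N\<close> carried by the tails of \<open>x\<close> are
  uniformly large at infinitely many points of \<open>W\<close>, hence at a weak cluster point, although
  they tend to \<open>0\<close> pointwise.\<close>

lemma weakly_null_of_dominated_by_relatively_weakly_compact:
  fixes x :: "nat \<Rightarrow> 'a::banach_lattice"
  assumes W: "relatively_weakly_compact W" and x: "disjoint_seq x"
    and y: "\<And>n. y n \<in> W" "\<And>n. \<bar>x n\<bar> \<le> y n"
  shows "weakly_null x"
  unfolding weakly_null_iff
proof (rule allI, rule ccontr)
  fix f :: "'a \<Rightarrow>\<^sub>L real" assume "\<not> (\<lambda>n. f (x n)) \<longlonglongrightarrow> 0"
  then obtain e where e: "e > 0" "\<And>N. \<exists>n\<ge>N. e \<le> \<bar>f (x n)\<bar>"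
    by (force simp: LIMSEQ_def not_less)
  define P where "P N g \<longleftrightarrow> (\<forall>y\<ge>0. blinfun_apply g y = (SUP z\<in>{z\<in>tail_ideal x N. \<bar>z\<bar> \<le> y}. f z))
      \<and> (\<forall>y z. z \<in> tail_ideal x N \<longrightarrow> \<bar>z\<bar> \<le> y \<longrightarrow> f z \<le> g y)" for N and g :: "'a \<Rightarrow>\<^sub>L real"
  have "\<exists>g. P N g" for N
    by (rule ideal_functional[OF subspace_tail_ideal[of x N] tail_ideal_solid, where f = f])
      (auto simp: P_def)
  then obtain g where "\<And>N. P N (g N)" using choice[of P] by blast
  then have g: "\<And>N y. 0 \<le> y \<Longrightarrow> g N y = (SUP z\<in>{z\<in>tail_ideal x N. \<bar>z\<bar> \<le> y}. f z)" and
    g_ge: "\<And>N y z. z \<in> tail_ideal x N \<Longrightarrow> \<bar>z\<bar> \<le> y \<Longrightarrow> f z \<le> g N y"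
    by (simp_all add: P_def)
  have g_small: "\<exists>N. \<forall>M\<ge>N. g M y < d" if y: "0 \<le> y" and d: "d > 0" for y d
  proof (rule ccontr)
    assume "\<nexists>N. \<forall>M\<ge>N. g M y < d"
    then have *: "\<exists>M\<ge>N. d \<le> g M y" for N by (auto simp: not_less)
    \<comment> \<open>The supremum that defines \<open>g M y\<close> need not be attained;
      \<open>d / 2\<close> leaves room to choose a witness.\<close>
    have "d / 2 \<le> 0"
    proof (rule disjoint_functional_bound[OF x y])
      fix N
      obtain M where M: "M \<ge> N" "d \<le> g M y" using * by blast
      then have "d / 2 < (SUP z\<in>{z\<in>tail_ideal x M. \<bar>z\<bar> \<le> y}. f z)"
        using d g[OF y, of M] by simp
      moreover have "0 \<in> {z\<in>tail_ideal x M. \<bar>z\<bar> \<le> y}"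
        using y by (auto intro: subspace_0 subspace_tail_ideal)
      ultimately obtain z where "z \<in> tail_ideal x M" "\<bar>z\<bar> \<le> y" "d / 2 < f z"
        by (subst (asm) less_cSUP_iff) (auto intro!: bdd_aboveI2 g_ge)
      then show "\<exists>z\<in>tail_ideal x N. \<bar>z\<bar> \<le> y \<and> d / 2 \<le> f z"
        using tail_ideal_antimono[OF M(1), of x] by (intro bexI[of _ z]) auto
    qed
    then show False using d by simp
  qed
  have xI: "x n \<in> tail_ideal x N" if "N \<le> n" for n N
  proof -
    have "\<bar>x n\<bar> \<le> (\<Sum>m\<in>{N..<Suc n}. \<bar>x m\<bar>)"
      using sum_mono2[of "{N..<Suc n}" "{n}" "\<lambda>m. \<bar>x m\<bar>"] that by auto
    also have "\<dots> \<le> real (Suc n) *\<^sub>R (\<Sum>m\<in>{N..<Suc n}. \<bar>x m\<bar>)"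
      using scaleR_right_mono[of 1 "real (Suc n)" "\<Sum>m\<in>{N..<Suc n}. \<bar>x m\<bar>"] by (simp add: sum_nonneg)
    finally show ?thesis unfolding tail_ideal_def by blast
  qed
  have large: "\<bar>f (x n)\<bar> \<le> g N (y n)" if "N \<le> n" for n N
    using g_ge[OF xI[OF that] y(2)] g_ge[of "- x n", OF _ , of N "y n"] y(2)[of n]
      subspace_neg[OF subspace_tail_ideal xI[OF that]]
    by (auto simp: abs_le_iff blinfun.minus_right)
  define K where "K = weak_topology closure_of W"
  define C where "C N = blinfun_apply (g N) -` {e..}" for N
  have "closedin weak_topology (C N)" for N
  proof -
    have "UNIV - C N = blinfun_apply (g N) -` {..<e}" by (auto simp: C_def)
    then show ?thesis
      using openin_weak_vimage[of "{..<e}" "g N"] by (simp add: closedin_def)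
  qed
  \<comment> \<open>Only finitely many tails occur; a single index \<open>n\<close> beyond all of
    them with \<open>\<bar>f (x n)\<bar> \<ge> e\<close> provides the common point
    \<open>y n\<close>.\<close>
  moreover have "K \<inter> \<Inter>\<F> \<noteq> {}" if fin: "finite \<F>" "\<F> \<subseteq> range C" for \<F>
  proof -
    obtain F where F: "finite F" "\<F> = C ` F" using finite_subset_image[OF fin] by auto
    then obtain m where m: "F \<subseteq> {..m}" using finite_nat_iff_bounded_le by blast
    obtain n where n: "n \<ge> m" "e \<le> \<bar>f (x n)\<bar>" using e(2) by blast
    have "e \<le> g N (y n)" if "N \<in> F" for N
    proof -
      have "N \<le> n" using m n that by auto
      then show ?thesis using large n order_trans by blast
    qed
    then have "y n \<in> \<Inter>\<F>" by (auto simp: F C_def)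
    moreover have "y n \<in> K"
      unfolding K_def using y(1) closure_of_subset[of W weak_topology] by auto
    ultimately show ?thesis by auto
  qed
  moreover have "compactin weak_topology K" using W by (simp add: K_def relatively_weakly_compact_def)
  ultimately have "K \<inter> \<Inter>(range C) \<noteq> {}" by (auto simp: compactin_fip)
  then obtain v where v: "\<And>N. e \<le> g N v" by (auto simp: C_def)
  \<comment> \<open>\<open>g_small\<close> speaks of positive vectors, so \<open>v\<close> is split;
    the negative part can only lower the value because \<open>g N\<close> is positive.\<close>
  obtain N where "g N (pprt v) < e"
    using g_small[of "pprt v" e] e by auto
  moreover have "g N (nprt v) \<le> 0"
  proof -
    have "f 0 \<le> g N (- nprt v)"
      by (rule g_ge) (auto intro: subspace_0 subspace_tail_ideal)
    then show ?thesis by (simp add: blinfun.minus_right)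
  qed
  moreover have "g N v = g N (pprt v) + g N (nprt v)"
    using prts[of v] by (simp flip: blinfun.add_right)
  ultimately show False using v[of N] by simp
qed

section \<open>The space \<open>\<ell>\<^sub>1\<close>\<close>

text \<open>The norm is set to \<open>0\<close> off the carrier: \<open>suminf\<close> has no usable value there, but distances have
  to be nonnegative everywhere.\<close>

definition ell1_copy :: "((nat \<Rightarrow> real) \<Rightarrow> 'x) \<Rightarrow> 'x nspace" where
  "ell1_copy f = \<lparr>ns_carrier = f ` ns_carrier ell1, ns_zero = f (\<lambda>n. 0),
     ns_add = (\<lambda>u v. f (\<lambda>n. inv f u n + inv f v n)), ns_scale = (\<lambda>c u. f (\<lambda>n. c * inv f u n)),
     ns_norm = (\<lambda>u. if summable (\<lambda>n. \<bar>inv f u n\<bar>) then \<Sum>n. \<bar>inv f u n\<bar> else 0)\<rparr>"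

lemma carrier_ell1_iff: "a \<in> ns_carrier ell1 \<longleftrightarrow> summable (\<lambda>n. \<bar>a n\<bar>)"
  by (simp add: ell1_def)

lemma summable_abs_add:
  fixes a b :: "nat \<Rightarrow> real"
  shows "summable (\<lambda>n. \<bar>a n\<bar>) \<Longrightarrow> summable (\<lambda>n. \<bar>b n\<bar>) \<Longrightarrow> summable (\<lambda>n. \<bar>a n + b n\<bar>)"
  by (rule summable_comparison_test[of _ "\<lambda>n. \<bar>a n\<bar> + \<bar>b n\<bar>"]) (auto intro: summable_add)

lemma suminf_abs_add_le:
  fixes a b :: "nat \<Rightarrow> real"
  assumes "summable (\<lambda>n. \<bar>a n\<bar>)" "summable (\<lambda>n. \<bar>b n\<bar>)"
  shows "(\<Sum>n. \<bar>a n + b n\<bar>) \<le> (\<Sum>n. \<bar>a n\<bar>) + (\<Sum>n. \<bar>b n\<bar>)"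
proof -
  have "(\<Sum>n. \<bar>a n + b n\<bar>) \<le> (\<Sum>n. \<bar>a n\<bar> + \<bar>b n\<bar>)"
    using assms by (intro suminf_le summable_abs_add summable_add) auto
  then show ?thesis using assms by (simp add: suminf_add)
qed

lemma suminf_abs_eq_0_iff:
  fixes a :: "nat \<Rightarrow> real"
  assumes "summable (\<lambda>n. \<bar>a n\<bar>)"
  shows "(\<Sum>n. \<bar>a n\<bar>) = 0 \<longleftrightarrow> a = (\<lambda>n. 0)"
  using assms by (subst suminf_eq_zero_iff) auto

text \<open>\<open>ell1\<close> is a carrier within a function type and not a type of class
  \<open>banach\<close>, so \<open>banach_space_transport\<close> does not cover it. For
  completeness, Cauchy sequences converge coordinatewise, and bounds on finite partial sums pass to
  the limit.\<close>

lemma banach_space_ell1_copy: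
  fixes f :: "(nat \<Rightarrow> real) \<Rightarrow> 'x"
  assumes f: "inj f"
  shows "banach_space (ell1_copy f)"
proof -
  let ?X = "ell1_copy f" and ?C = "ns_carrier (ell1_copy f)"
  have C: "?C = f ` {a. summable (\<lambda>n. \<bar>a n\<bar>)}" by (simp add: ell1_copy_def ell1_def)
  have d: "ns_dist ?X u v = (if summable (\<lambda>n. \<bar>inv f u n - inv f v n\<bar>)
      then \<Sum>n. \<bar>inv f u n - inv f v n\<bar> else 0)" for u v
    using f by (simp add: ns_dist_def ell1_copy_def)
  have diff: "summable (\<lambda>n. \<bar>a n - b n\<bar>)"
    if "summable (\<lambda>n. \<bar>a n\<bar>)" "summable (\<lambda>n. \<bar>b n\<bar>)" for a b :: "nat \<Rightarrow> real"
    using summable_abs_add[of a "\<lambda>n. - b n"] that by simp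
  interpret M: Metric_space ?C "ns_dist ?X"
  proof
    fix u v
    show "0 \<le> ns_dist ?X u v" by (auto simp: d intro: suminf_nonneg)
    show "ns_dist ?X u v = ns_dist ?X v u" by (simp add: d abs_minus_commute)
  next
    fix u v assume "u \<in> ?C" "v \<in> ?C"
    then show "ns_dist ?X u v = 0 \<longleftrightarrow> u = v"
      using f suminf_abs_eq_0_iff[of "\<lambda>n. inv f u n - inv f v n"]
      by (auto simp: C d diff inj_eq fun_eq_iff)
  next
    fix u v w assume "u \<in> ?C" "v \<in> ?C" "w \<in> ?C"
    then obtain a b c where "u = f a" "v = f b" "w = f c" "summable (\<lambda>n. \<bar>a n\<bar>)"
      "summable (\<lambda>n. \<bar>b n\<bar>)" "summable (\<lambda>n. \<bar>c n\<bar>)" by (auto simp: C)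
    then show "ns_dist ?X u w \<le> ns_dist ?X u v + ns_dist ?X v w"
      using f suminf_abs_add_le[of "\<lambda>n. a n - b n" "\<lambda>n. b n - c n"] by (simp add: d diff)
  qed
  have "M.mcomplete"
    unfolding M.mcomplete_def
  proof (intro allI impI)
    fix s assume s: "M.MCauchy s"
    then have "range s \<subseteq> f ` {a. summable (\<lambda>n. \<bar>a n\<bar>)}" by (simp add: M.MCauchy_def flip: C)
    then have "\<forall>k. \<exists>a. s k = f a \<and> summable (\<lambda>n. \<bar>a n\<bar>)" by blast
    then obtain t where t: "\<And>k. s k = f (t k)" "\<And>k. summable (\<lambda>n. \<bar>t k n\<bar>)" by metis
    have cau: "\<exists>N. \<forall>i\<ge>N. \<forall>j\<ge>N. (\<Sum>n. \<bar>t i n - t j n\<bar>) < e" if "e > 0" for e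
      using s that f by (simp add: M.MCauchy_def d t diff)
    have le: "\<bar>t i n - t j n\<bar> \<le> (\<Sum>n. \<bar>t i n - t j n\<bar>)" for i j n
      using sum_le_suminf[OF diff[OF t(2)[of i] t(2)[of j]], of "{n}"] by simp
    have "\<exists>l. (\<lambda>k. t k n) \<longlonglongrightarrow> l" for n
    proof -
      have "Cauchy (\<lambda>k. t k n)"
        unfolding Cauchy_def dist_real_def
      proof (intro allI impI)
        fix e :: real assume "e > 0"
        then obtain N where "\<forall>i\<ge>N. \<forall>j\<ge>N. (\<Sum>n. \<bar>t i n - t j n\<bar>) < e" using cau by blast
        then show "\<exists>N. \<forall>i\<ge>N. \<forall>j\<ge>N. \<bar>t i n - t j n\<bar> < e"
          by (intro exI[of _ N]) (auto intro: le_less_trans[OF le])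
      qed
      then show ?thesis by (simp add: Cauchy_convergent_iff convergent_def)
    qed
    then obtain l where l: "\<And>n. (\<lambda>k. t k n) \<longlonglongrightarrow> l n" by metis
    have near: "summable (\<lambda>n. \<bar>t i n - l n\<bar>) \<and> (\<Sum>n. \<bar>t i n - l n\<bar>) \<le> e"
      if N: "\<forall>i\<ge>N. \<forall>j\<ge>N. (\<Sum>n. \<bar>t i n - t j n\<bar>) < e" and i: "i \<ge> N" for e N i
    proof -
      have fin: "(\<Sum>n<m. \<bar>t i n - l n\<bar>) \<le> e" for m
      proof (rule tendsto_upperbound)
        show "(\<lambda>j. \<Sum>n<m. \<bar>t i n - t j n\<bar>) \<longlonglongrightarrow> (\<Sum>n<m. \<bar>t i n - l n\<bar>)"
          by (intro tendsto_intros l)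
        show "\<forall>\<^sub>F j in sequentially. (\<Sum>n<m. \<bar>t i n - t j n\<bar>) \<le> e"
          using eventually_ge_at_top[of N]
        proof eventually_elim
          case (elim j)
          have "(\<Sum>n<m. \<bar>t i n - t j n\<bar>) \<le> (\<Sum>n. \<bar>t i n - t j n\<bar>)"
            by (intro sum_le_suminf diff t) auto
          then show ?case using N i elim by (meson less_imp_le order_trans)
        qed
      qed simp
      then have "summable (\<lambda>n. \<bar>t i n - l n\<bar>)"
        by (intro bounded_imp_summable[of _ e]) (simp_all only: lessThan_Suc_atMost[symmetric] abs_ge_zero)
      with fin show ?thesis by (auto intro: suminf_le_const)
    qed
    have "summable (\<lambda>n. \<bar>l n\<bar>)"
    proof -
      obtain N where "\<forall>i\<ge>N. \<forall>j\<ge>N. (\<Sum>n. \<bar>t i n - t j n\<bar>) < 1" using cau[of 1] by auto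
      then have "summable (\<lambda>n. \<bar>t N n - l n\<bar>)" using near by blast
      from diff[OF t(2)[of N] this] show ?thesis by simp
    qed
    moreover have "\<exists>N. \<forall>i\<ge>N. (\<Sum>n. \<bar>t i n - l n\<bar>) < e" if e: "e > 0" for e
    proof -
      obtain N where "\<forall>i\<ge>N. \<forall>j\<ge>N. (\<Sum>n. \<bar>t i n - t j n\<bar>) < e / 2"
        using cau[OF half_gt_zero[OF e]] by blast
      then have "\<forall>i\<ge>N. (\<Sum>n. \<bar>t i n - l n\<bar>) \<le> e / 2" using near by blast
      then show ?thesis using e by (intro exI[of _ N]) (auto intro: le_less_trans[of _ "e / 2"])
    qed
    ultimately have "limitin M.mtopology s (f l) sequentially"
      unfolding M.limitin_metric eventually_sequentially
      using f t(2) by (auto simp: t(1) C d diff)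
    then show "\<exists>u. limitin M.mtopology s u sequentially" ..
  qed
  moreover have "\<exists>v\<in>?C. ns_add ?X u v = ns_zero ?X" if "u \<in> ?C" for u
    using that f by (auto simp: ell1_copy_def carrier_ell1_iff intro!: bexI[of _ "\<lambda>n. - inv f u n"])
  ultimately show ?thesis
    using f by unfold_locales
      (auto simp: ell1_copy_def ell1_def algebra_simps inj_eq abs_mult summable_mult suminf_mult suminf_nonneg
        suminf_abs_eq_0_iff suminf_abs_add_le summable_abs_add intro: arg_cong[of _ _ f])
qed

section \<open>Operators on \<open>\<ell>\<^sub>1\<close> induced by weakly null sequences\<close>

text \<open>If \<open>norm (x (r k))\<close> exceeds \<open>k * 2 ^ k\<close>, weight a positive
  functional norming \<open>x (r k)\<close> by \<open>(1/2) ^ k\<close>. On positive vectors the sum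
  of all these dominates each summand, hence is at least \<open>k\<close> at \<open>x (r k)\<close>,
  although every functional is bounded along a weakly null sequence.\<close>

lemma positive_weakly_null_bounded:
  fixes x :: "nat \<Rightarrow> 'a::banach_lattice"
  assumes x: "weakly_null x" "\<And>n. 0 \<le> x n"
  obtains K where "0 \<le> K" "\<And>n. norm (x n) \<le> K"
proof -
  have "\<exists>K. \<forall>n. norm (x n) \<le> K"
  proof (rule ccontr)
    assume "\<not> ?thesis"
    then have "\<forall>k::nat. \<exists>n. real k * 2 ^ k < norm (x n)" by (force simp: not_le)
    then obtain r where r: "\<And>k. real k * 2 ^ k < norm (x (r k))" by metis
    have "\<forall>k. \<exists>f :: 'a \<Rightarrow>\<^sub>L real. f (x (r k)) = norm (x (r k)) \<and> (\<forall>y\<ge>0. 0 \<le> f y) \<and> (\<forall>y. \<bar>f y\<bar> \<le> norm y)"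
      using positive_norming_functional x(2) by metis
    then obtain f :: "nat \<Rightarrow> 'a \<Rightarrow>\<^sub>L real" where
      f: "\<And>k. f k (x (r k)) = norm (x (r k))" "\<And>k y. 0 \<le> y \<Longrightarrow> 0 \<le> f k y" "\<And>k y. \<bar>f k y\<bar> \<le> norm y"
      by metis
    define g where "g k = (1/2) ^ k *\<^sub>R f k" for k
    have "norm (f k) \<le> 1" for k
      using f(3) by (intro norm_blinfun_bound) auto
    then have sg: "summable g"
      by (intro summable_comparison_test[of g "\<lambda>k. (1/2) ^ k"] summable_geometric)
        (auto simp: g_def mult_le_cancel_left1 intro!: exI[of _ 0])
    have sum_at: "summable (\<lambda>k. g k y)" "suminf g y = (\<Sum>k. g k y)" for y
      using bounded_linear.summable[OF blinfun.bounded_linear_left sg]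
        bounded_linear.suminf[OF blinfun.bounded_linear_left sg] by auto
    have *: "g k (x n) \<le> suminf g (x n)" for k n
    proof -
      have "0 \<le> g j (x n)" for j
        using f(2)[OF x(2)] by (simp add: g_def scaleR_blinfun.rep_eq)
      then show ?thesis
        using sum_le_suminf[OF sum_at(1), of "{k}" "x n"] by (simp add: sum_at(2))
    qed
    have big: "real k \<le> suminf g (x (r k))" for k
    proof -
      have "real k \<le> g k (x (r k))"
        using r[of k] by (simp add: g_def scaleR_blinfun.rep_eq f(1) field_simps)
      then show ?thesis using *[of k "r k"] by simp
    qed
    have "Bseq (\<lambda>n. suminf g (x n))"
      using x(1) by (intro convergent_imp_Bseq convergentI[of _ 0]) (simp add: weakly_null_iff)
    then obtain B where B: "\<And>n. \<bar>suminf g (x n)\<bar> \<le> B" by (auto simp: Bseq_def)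
    obtain k :: nat where "B < real k" using reals_Archimedean2 by blast
    then show False using big[of k] B[of "r k"] by simp
  qed
  then obtain K where K: "\<And>n. norm (x n) \<le> K" by blast
  then show ?thesis using order_trans[OF norm_ge_zero K] by (intro that[of K]) auto
qed

definition combination :: "(nat \<Rightarrow> 'a::banach) \<Rightarrow> (nat \<Rightarrow> real) \<Rightarrow> 'a" where
  "combination x a = (\<Sum>n. a n *\<^sub>R x n)"

context
  fixes x :: "nat \<Rightarrow> 'a::banach" and K
  assumes K: "0 \<le> K" "\<And>n. norm (x n) \<le> K"
begin

lemma norm_combination_term: "norm (a n *\<^sub>R x n) \<le> K * \<bar>a n\<bar>"
  using K mult_right_mono[of "norm (x n)" K "\<bar>a n\<bar>"] by (simp add: mult.commute)

lemma summable_norm_combination: "a \<in> ns_carrier ell1 \<Longrightarrow> summable (\<lambda>n. norm (a n *\<^sub>R x n))"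
  by (rule summable_comparison_test'[of "\<lambda>n. K * \<bar>a n\<bar>" 0])
    (simp_all add: carrier_ell1_iff summable_mult norm_combination_term del: norm_scaleR)

lemmas summable_combination = summable_norm_cancel[OF summable_norm_combination]

lemma bounded_operator_combination: "bounded_operator ell1 (combination x)"
  unfolding bounded_operator_def
proof (intro conjI ballI allI exI)
  fix a b c assume a: "a \<in> ns_carrier ell1"
  show "combination x (ns_scale ell1 c a) = c *\<^sub>R combination x a"
    using suminf_scaleR_right[OF summable_combination[OF a], of c]
    by (simp add: combination_def ell1_def)
  show "norm (combination x a) \<le> K * ns_norm ell1 a"
  proof -
    have s: "summable (\<lambda>n. \<bar>a n\<bar>)" using a by (simp add: carrier_ell1_iff)
    have "norm (combination x a) \<le> (\<Sum>n. norm (a n *\<^sub>R x n))"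
      unfolding combination_def by (rule summable_norm[OF summable_norm_combination[OF a]])
    also have "\<dots> \<le> (\<Sum>n. K * \<bar>a n\<bar>)"
      by (intro suminf_le norm_combination_term summable_norm_combination a summable_mult s)
    finally show ?thesis using s by (simp add: suminf_mult ell1_def)
  qed
  fix b assume b: "b \<in> ns_carrier ell1"
  show "combination x (ns_add ell1 a b) = combination x a + combination x b"
    using suminf_add[OF summable_combination[OF a] summable_combination[OF b]]
    by (simp add: combination_def ell1_def scaleR_left_distrib)
qed

end

section \<open>The unit ball of \<open>ell1\<close> in the topology of coordinatewise
  convergence\<close>

lemma ball_ell1_eq: "ns_ball ell1 = {a. \<forall>N. (\<Sum>n<N. \<bar>a n\<bar>) \<le> 1}"
proof (intro set_eqI iffI)
  fix a assume "a \<in> ns_ball ell1"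
  then have a: "summable (\<lambda>n. \<bar>a n\<bar>)" "(\<Sum>n. \<bar>a n\<bar>) \<le> 1" by (auto simp: ns_ball_def ell1_def)
  have "(\<Sum>n<N. \<bar>a n\<bar>) \<le> (\<Sum>n. \<bar>a n\<bar>)" for N
    by (intro sum_le_suminf a) auto
  with a(2) show "a \<in> {a. \<forall>N. (\<Sum>n<N. \<bar>a n\<bar>) \<le> 1}"
    by (auto intro: order_trans)
next
  fix a :: "nat \<Rightarrow> real" assume a: "a \<in> {a. \<forall>N. (\<Sum>n<N. \<bar>a n\<bar>) \<le> 1}"
  have "summable (\<lambda>n. \<bar>a n\<bar>)"
    using a by (intro bounded_imp_summable[of _ 1]) (auto simp only: lessThan_Suc_atMost[symmetric] abs_ge_zero)
  with a show "a \<in> ns_ball ell1" by (auto simp: ns_ball_def ell1_def intro: suminf_le_const)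
qed

text \<open>\<open>compact\<close> refers to the product topology of
  \<open>nat \<Rightarrow> real\<close>. Each condition in \<open>ball_ell1_eq\<close> involves
  finitely many coordinates, so the ball is closed, and it lies in a cube that is compact by
  Tychonoff. This is the weak-star compactness of the ball of the dual of c_0.\<close>

lemma compact_ball_ell1: "compact (ns_ball ell1)"
proof -
  define Q where "Q = (PiE UNIV (\<lambda>n::nat. {-1..1::real}))"
  have "compactin (product_topology (\<lambda>n. euclidean) UNIV) Q"
    by (auto simp: Q_def compactin_PiE)
  then have "compact Q" by (simp add: euclidean_product_topology)
  moreover have "closed (ns_ball ell1)"
    unfolding ball_ell1_eq
    by (intro closed_Collect_all closed_Collect_le continuous_intros continuous_on_product_coordinates)
  moreover have "ns_ball ell1 \<subseteq> Q"
  proof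
    fix a assume a: "a \<in> ns_ball ell1"
    have "\<bar>a n\<bar> \<le> 1" for n
    proof -
      have "\<bar>a n\<bar> \<le> (\<Sum>n<Suc n. \<bar>a n\<bar>)" by (rule member_le_sum) auto
      then show ?thesis using a unfolding ball_ell1_eq by (blast intro: order_trans)
    qed
    then show "a \<in> Q" by (auto simp: Q_def abs_le_iff minus_le_iff)
  qed
  ultimately show ?thesis by (metis closed_Int_compact inf.absorb1)
qed

text \<open>The operator is continuous from the topology of coordinatewise convergence on the unit ball,
  which is compact, to the weak topology.\<close>

lemma weakly_compact_operator_combination:
  fixes x :: "nat \<Rightarrow> 'a::banach"
  assumes x: "weakly_null x" and K: "0 \<le> K" "\<And>n. norm (x n) \<le> K"
  shows "weakly_compact_operator ell1 (combination x)"
proof -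
  let ?B = "ns_ball ell1"
  have cont: "continuous_on ?B (\<lambda>a. f (combination x a))" for f :: "'a \<Rightarrow>\<^sub>L real"
  proof (rule uniform_limit_theorem)
    \<comment> \<open>Each \<open>S N\<close> depends on finitely many coordinates. Convergence is
      uniform on the ball because the tail from \<open>N\<close> on is at most the supremum of
      \<open>\<bar>f (x n)\<bar>\<close> over \<open>n \<ge> N\<close>; here weak nullness
      enters.\<close>
    define S where "S N a = (\<Sum>n<N. a n * f (x n))" for N and a :: "nat \<Rightarrow> real"
    show "\<forall>\<^sub>F N in sequentially. continuous_on ?B (S N)"
      unfolding S_def
      by (intro always_eventually allI continuous_intros continuous_on_subset[OF continuous_on_product_coordinates]) auto
    show "uniform_limit ?B S (\<lambda>a. f (combination x a)) sequentially"
      unfolding uniform_limit_iff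
    proof (intro allI impI)
      fix e :: real assume e: "e > 0"
      have "(\<lambda>n. f (x n)) \<longlonglongrightarrow> 0" using x by (simp add: weakly_null_iff)
      from LIMSEQ_D[OF this, of "e / 2"] e
      obtain N0 where N0: "\<And>n. n \<ge> N0 \<Longrightarrow> \<bar>f (x n)\<bar> < e / 2"
        by auto
      show "\<forall>\<^sub>F N in sequentially. \<forall>a\<in>?B. dist (S N a) (f (combination x a)) < e"
        using eventually_ge_at_top[of N0]
      proof eventually_elim
        case (elim N)
        show ?case
        proof
          fix a assume a: "a \<in> ?B"
          then have "a \<in> ns_carrier ell1" by (simp add: ns_ball_def)
          from summable_LIMSEQ[OF summable_combination[OF K this]]
          have "(\<lambda>M. f (\<Sum>n<M. a n *\<^sub>R x n)) \<longlonglongrightarrow> f (combination x a)"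
            unfolding combination_def by (intro tendsto_intros)
          then have lim: "(\<lambda>M. S M a) \<longlonglongrightarrow> f (combination x a)"
            by (simp add: S_def blinfun.sum_right blinfun.scaleR_right)
          have "\<forall>\<^sub>F M in sequentially. dist (S N a) (S M a) \<le> e / 2"
            using eventually_ge_at_top[of N]
          proof eventually_elim
            case (elim M)
            have "S M a - S N a = (\<Sum>n\<in>{N..<M}. a n * f (x n))"
              using elim by (simp add: S_def sum_diff_nat_ivl lessThan_atLeast0)
            also have "\<bar>\<dots>\<bar> \<le> (\<Sum>n\<in>{N..<M}. \<bar>a n * f (x n)\<bar>)" by (rule sum_abs)
            also have "\<dots> \<le> (\<Sum>n\<in>{N..<M}. \<bar>a n\<bar> * (e / 2))"
              using N0 \<open>N0 \<le> N\<close> unfolding abs_mult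
              by (intro sum_mono mult_left_mono) (auto intro!: less_imp_le)
            also have "\<dots> = (e / 2) * (\<Sum>n\<in>{N..<M}. \<bar>a n\<bar>)" by (simp add: sum_distrib_left mult.commute)
            also have "\<dots> \<le> (e / 2) * (\<Sum>n<M. \<bar>a n\<bar>)"
              using e by (intro mult_left_mono sum_mono2) auto
            also have "\<dots> \<le> (e / 2) * 1"
              using e a unfolding ball_ell1_eq by (intro mult_left_mono) auto
            finally show ?case by (simp add: dist_real_def abs_minus_commute)
          qed
          then have "dist (S N a) (f (combination x a)) \<le> e / 2"
            by (rule tendsto_upperbound[OF tendsto_dist[OF tendsto_const lim]]) simp
          then show "dist (S N a) (f (combination x a)) < e" using e by simp
        qed
      qed
    qed
  qed simp
  have "continuous_map (top_of_set ?B) weak_topology (combination x)"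
    unfolding weak_topology_def
  proof (rule continuous_on_generated_topo)
    fix V assume "V \<in> {blinfun_apply f -` U |(f :: 'a \<Rightarrow>\<^sub>L real) U. open U}"
    then obtain f :: "'a \<Rightarrow>\<^sub>L real" and U where V: "V = blinfun_apply f -` U" "open U" by auto
    show "openin (top_of_set ?B) (combination x -` V \<inter> topspace (top_of_set ?B))"
      using continuous_openin_preimage_gen[OF cont[of f] V(2)] by (simp add: V vimage_def Int_commute)
  next
    show "combination x ` topspace (top_of_set ?B) \<subseteq> \<Union> {blinfun_apply f -` U |(f :: 'a \<Rightarrow>\<^sub>L real) U. open U}"
      using topspace_weak_topology[where 'a='a]
      unfolding weak_topology_def topology_generated_by_topspace by simp
  qed
  moreover have "compactin (top_of_set ?B) ?B"
    using compact_ball_ell1 by (simp add: compactin_subtopology)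
  ultimately have "compactin weak_topology (combination x ` ?B)" by (rule image_compactin[rotated])
  moreover from this have "weak_topology closure_of (combination x ` ?B) = combination x ` ?B"
    by (intro closure_of_closedin compactin_imp_closedin Hausdorff_weak_topology)
  ultimately show ?thesis
    using bounded_operator_combination[OF K]
    by (simp add: weakly_compact_operator_def relatively_weakly_compact_def)
qed

section \<open>Disjoint sequences from almost disjoint ones\<close>

text \<open>In the construction, smallness is imposed for all indices up to \<open>r n\<close> and
  not only for the chosen ones, so that the next choice depends on the last index alone and
  dependent choice applies.\<close>

lemma subsequence_with_small_interaction:
  fixes a :: "nat \<Rightarrow> nat \<Rightarrow> real" and e :: "nat \<Rightarrow> real"
  assumes a: "\<And>i. (\<lambda>n. a i n) \<longlonglongrightarrow> 0" and e: "\<And>n. 0 < e n"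
    and Q: "\<And>N. \<exists>n\<ge>N. Q n"
  obtains r :: "nat \<Rightarrow> nat" where "strict_mono r" "\<And>n. Q (r n)" "\<And>j n. j < n \<Longrightarrow> a (r j) (r n) < e n"
proof -
  have "\<exists>r. \<forall>n. Q (r n) \<and> (r n < r (Suc n) \<and> (\<forall>i\<le>r n. a i (r (Suc n)) < e (Suc n)))"
  proof (rule dependent_nat_choice)
    show "\<exists>m. Q m" using Q by blast
    fix m n
    have "\<forall>\<^sub>F k in sequentially. \<forall>i\<in>{..m}. a i k < e (Suc n)"
      using order_tendstoD(2)[OF a e] by (intro eventually_ball_finite) auto
    then obtain N where "\<And>k. k \<ge> N \<Longrightarrow> \<forall>i\<in>{..m}. a i k < e (Suc n)"
      by (auto simp: eventually_sequentially)
    moreover obtain k where "k \<ge> max N (Suc m)" "Q k" using Q by blast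
    ultimately show "\<exists>k. Q k \<and> (m < k \<and> (\<forall>i\<le>m. a i k < e (Suc n)))"
      by (intro exI[of _ k]) auto
  qed
  then obtain r where r: "\<And>n. Q (r n)" "\<And>n. r n < r (Suc n)"
    "\<And>n i. i \<le> r n \<Longrightarrow> a i (r (Suc n)) < e (Suc n)" by blast
  have mono: "strict_mono r" using r(2) by (simp add: strict_mono_Suc_iff)
  have "a (r j) (r n) < e n" if jn: "j < n" for j n
  proof -
    obtain m where m: "n = Suc m" "j \<le> m" using jn by (cases n) auto
    then show ?thesis using r(3)[of "r j" m] mono by (simp add: strict_mono_less_eq)
  qed
  with mono r(1) show ?thesis by (intro that) auto
qed

text \<open>Removing from each term its intersections with all the others makes the terms disjoint; if the
  intersections are summably small, little norm is lost.\<close>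

lemma tendsto_0_of_almost_disjoint:
  fixes v :: "nat \<Rightarrow> 'a::banach_lattice"
  assumes v: "\<And>n. 0 \<le> v n" and inf0: "\<And>i. (\<lambda>n. inf (v i) (v n)) \<longlonglongrightarrow> 0"
    and disj: "\<And>y. \<lbrakk>disjoint_seq y; \<And>n. 0 \<le> y n; \<And>n. \<exists>m. y n \<le> v m\<rbrakk> \<Longrightarrow> y \<longlonglongrightarrow> 0"
  shows "v \<longlonglongrightarrow> 0"
proof (rule ccontr)
  assume "\<not> v \<longlonglongrightarrow> 0"
  then obtain e where e: "e > 0" "\<And>N. \<exists>n\<ge>N. e \<le> norm (v n)"
    by (force simp: LIMSEQ_def not_less)
  define q where "q n = (1/2::real) ^ n" for n
  have q: "summable q" "suminf q = 2" "\<And>n. 0 < q n" "\<And>n. q n \<le> 1"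
    using suminf_geometric[of "1/2::real"] summable_geometric[of "1/2::real"]
    by (simp_all add: q_def[abs_def] power_le_one)
  have "(\<lambda>n. norm (inf (v i) (v n))) \<longlonglongrightarrow> 0" for i
    using tendsto_norm[OF inf0[of i]] by simp
  then obtain r where r: "strict_mono r" "\<And>n. e \<le> norm (v (r n))"
    and small: "\<And>j n. j < n \<Longrightarrow> norm (inf (v (r j)) (v (r n))) < e / 4 * q n * q n"
    using subsequence_with_small_interaction[of "\<lambda>i n. norm (inf (v i) (v n))" "\<lambda>n. e / 4 * q n * q n"
        "\<lambda>n. e \<le> norm (v n)"] e q(3) by (metis (no_types, lifting) divide_pos_pos mult_pos_pos zero_less_numeral)
  define z where "z n = v (r n)" for n
  define b where "b n m = (if m = n then 0 else inf (z n) (z m))" for n m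
  have b_nonneg: "0 \<le> b n m" for n m by (simp add: b_def z_def v)
  \<comment> \<open>The bound depends on \<open>m\<close> only. As \<open>q\<close> sums to 2, the
    total subtracted from \<open>z n\<close> has norm at most \<open>e / 2\<close>, half of the
    lower bound \<open>e\<close>.\<close>
  have b_small: "norm (b n m) \<le> e / 4 * q m" for n m
  proof -
    have *: "norm (inf (z j) (z k)) \<le> e / 4 * q k * q i" if "j < k" "i \<le> k" for i j k
    proof -
      have "q k \<le> q i" using that by (auto simp: q_def intro: power_decreasing)
      then have "e / 4 * q k * q k \<le> e / 4 * q k * q i"
        using e q(3)[of k] by (intro mult_left_mono) auto
      then show ?thesis using small[OF that(1)] by (simp add: z_def)
    qed
    consider "m = n" | "n < m" | "m < n" by linarith
    then show ?thesis
    proof cases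
      case 2
      have "q 0 = 1" by (simp add: q_def)
      then show ?thesis using *[OF 2, of 0] 2 by (simp add: b_def)
    next
      case 3
      have "e / 4 * q n * q m \<le> e / 4 * 1 * q m"
        using e q by (intro mult_right_mono mult_left_mono) (auto intro: less_imp_le)
      then show ?thesis using *[OF 3, of m] 3 by (simp add: b_def inf_commute)
    qed (use e q(3)[of m] in \<open>simp add: b_def\<close>)
  qed
  have sq: "summable (\<lambda>m. e / 4 * q m)" by (intro summable_mult q)
  have sum_norm: "summable (\<lambda>m. norm (b n m))" for n
    by (rule summable_comparison_test'[OF sq, of 0]) (simp only: real_norm_def abs_norm_cancel b_small)
  then have sum: "summable (b n)" for n by (rule summable_norm_cancel)
  \<comment> \<open>Keeping a single overlap shows \<open>y n \<le> z n - inf (z n) (z m)\<close>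
    for \<open>m\<close> other than \<open>n\<close>, and the corresponding remainders of
    \<open>z n\<close> and \<open>z m\<close> are disjoint.\<close>
  define y where "y n = pprt (z n - suminf (b n))" for n
  have y_le: "y n \<le> z n - b n m" for n m
  proof -
    have "z n - suminf (b n) \<le> z n - b n m"
      using term_le_suminf_lattice[OF sum b_nonneg] by simp
    moreover have "0 \<le> z n - b n m" using v by (simp add: b_def z_def)
    ultimately show ?thesis by (simp add: y_def pprt_def)
  qed
  have y_nonneg: "0 \<le> y n" for n by (simp add: y_def)
  have "inf (y n) (y m) = 0" if "n \<noteq> m" for n m
  proof (rule antisym)
    have "inf (y n) (y m) \<le> inf (z n - inf (z n) (z m)) (z m - inf (z n) (z m))"
      using y_le[of n m] y_le[of m n] that by (intro inf_mono) (auto simp: b_def inf_commute)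
    then show "inf (y n) (y m) \<le> 0" by (simp only: disjoint_diff_inf)
  qed (simp add: y_nonneg)
  then have "disjoint_seq y" by (simp add: disjoint_seq_def y_nonneg)
  moreover have "\<exists>m. y n \<le> v m" for n
    using y_le[of n n] by (auto simp: b_def z_def)
  ultimately have "y \<longlonglongrightarrow> 0" using disj y_nonneg by blast
  moreover have "e / 2 \<le> norm (y n)" for n
  proof -
    have "norm (suminf (b n)) \<le> (\<Sum>m. norm (b n m))" by (rule summable_norm[OF sum_norm])
    also have "\<dots> \<le> (\<Sum>m. e / 4 * q m)" by (rule suminf_le[OF b_small sum_norm sq])
    also have "\<dots> = e / 2" using suminf_mult[OF q(1), of "e / 4"] by (simp only: q(2))
    finally have "norm (suminf (b n)) \<le> e / 2" .
    moreover have "norm (z n) \<le> norm (y n) + norm (suminf (b n))"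
    proof -
      have "z n - suminf (b n) \<le> y n" by (simp add: y_def pprt_def)
      then have "z n \<le> y n + suminf (b n)" by (simp add: diff_le_eq)
      then have "norm (z n) \<le> norm (y n + suminf (b n))"
        using v by (intro norm_mono_nonneg) (auto simp: z_def)
      then show ?thesis using norm_triangle_ineq order_trans by blast
    qed
    ultimately show ?thesis using r(2)[of n] by (simp add: z_def)
  qed
  ultimately have "e / 2 \<le> 0"
    using tendsto_lowerbound[OF tendsto_norm[of y 0 sequentially], of "e / 2"] by auto
  then show False using e by simp
qed

section \<open>Order intervals with norm null disjoint sequences\<close>

text \<open>Order continuity of the norm below \<open>u\<close>, in the form that L-weak compactness
  delivers; \<open>convergent_of_antimono\<close> turns it into convergence of decreasing
  sequences.\<close>

definition disjointly_null_below :: "'a::banach_lattice \<Rightarrow> bool" where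
  "disjointly_null_below u \<longleftrightarrow> (\<forall>y. disjoint_seq y \<longrightarrow> (\<forall>n. 0 \<le> y n \<and> y n \<le> u) \<longrightarrow> y \<longlonglongrightarrow> 0)"

text \<open>Induction on the multiplicity of overlaps: a lower bound shared by \<open>k + 1\<close>
  of the meets with a fixed \<open>v i\<close> is shared by \<open>k + 2\<close> terms of
  \<open>v\<close> once \<open>v i\<close> is added. So these meets tend to 0, and \<open>v\<close>
  is almost disjoint.\<close>

lemma tendsto_0_of_bounded_overlap:
  fixes v :: "nat \<Rightarrow> 'a::banach_lattice"
  assumes u: "disjointly_null_below u" and v: "\<And>n. 0 \<le> v n" "\<And>n. v n \<le> u"
    and overlap: "\<And>t F. \<lbrakk>finite F; card F = Suc k; \<And>i. i \<in> F \<Longrightarrow> t \<le> v i\<rbrakk> \<Longrightarrow> t \<le> 0"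
  shows "v \<longlonglongrightarrow> 0"
  using v overlap
proof (induction k arbitrary: v)
  case 0
  have "v n = 0" for n
    using "0.prems"(3)[of "{n}" "v n"] "0.prems"(1)[of n] by (auto intro: antisym)
  then show ?case by (simp add: fun_eq_iff[symmetric])
next
  case (Suc k)
  show ?case
  proof (rule tendsto_0_of_almost_disjoint[OF Suc.prems(1)])
    fix i
    \<comment> \<open>Index \<open>i\<close> gets the value 0, so that lower bounds of a family
      containing \<open>i\<close> are trivially \<open>\<le> 0\<close> and \<open>v i\<close> is
      never counted twice.\<close>
    define w where "w n = (if n = i then 0 else inf (v i) (v n))" for n
    have "w \<longlonglongrightarrow> 0"
    proof (rule Suc.IH)
      show "0 \<le> w n" "w n \<le> u" for n
        using Suc.prems(1,2) order_trans[OF Suc.prems(1) Suc.prems(2)] by (auto simp: w_def intro: le_infI1)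
      fix t F assume F: "finite F" "card F = Suc k" "\<And>j. j \<in> F \<Longrightarrow> t \<le> w j"
      show "t \<le> 0"
      proof (cases "i \<in> F")
        case True
        then show ?thesis using F(3)[of i] by (simp add: w_def)
      next
        case False
        obtain j where "j \<in> F" using F(2) by (metis card.empty equals0I nat.distinct(1))
        have "t \<le> v j" if "j \<in> F" for j
          using F(3)[OF that] that False by (auto simp: w_def split: if_splits)
        moreover have "t \<le> v i"
          using F(3)[OF \<open>j \<in> F\<close>] \<open>j \<in> F\<close> False by (auto simp: w_def split: if_splits)
        ultimately show ?thesis
          using F False by (intro Suc.prems(3)[of "insert i F"]) auto
      qed
    qed
    then show "(\<lambda>n. inf (v i) (v n)) \<longlonglongrightarrow> 0"
      by (rule Lim_transform_eventually)
        (rule eventually_mono[OF eventually_gt_at_top[of i]], simp add: w_def)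
  next
    fix y assume y: "disjoint_seq y" "\<And>n. 0 \<le> y n" "\<And>n. \<exists>m. y n \<le> v m"
    then have "y n \<le> u" for n using Suc.prems(2) order_trans by blast
    with y show "y \<longlonglongrightarrow> 0" using u by (simp add: disjointly_null_below_def)
  qed
qed

text \<open>After subtracting \<open>u / K\<close>, no \<open>K\<close> of the terms overlap.\<close>

lemma tendsto_0_of_bounded_partial_sums:
  fixes v :: "nat \<Rightarrow> 'a::banach_lattice"
  assumes u: "disjointly_null_below u" and v: "\<And>n. 0 \<le> v n"
    and sum_le: "\<And>F. finite F \<Longrightarrow> sum v F \<le> u"
  shows "v \<longlonglongrightarrow> 0"
proof -
  have u0: "0 \<le> u" using sum_le[of "{}"] by simp
  have v_le: "v n \<le> u" for n using sum_le[of "{n}"] by simp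
  have approx: "(\<lambda>n. pprt (v n - (1 / real (Suc k)) *\<^sub>R u)) \<longlonglongrightarrow> 0" for k
  proof (rule tendsto_0_of_bounded_overlap[OF u, where k = k])
    let ?c = "(1 / real (Suc k)) *\<^sub>R u"
    show "pprt (v n - ?c) \<le> u" for n
    proof -
      have "v n - ?c \<le> v n" using u0 by (simp add: scaleR_nonneg_nonneg)
      then have "v n - ?c \<le> u" using v_le order_trans by blast
      then show ?thesis using u0 by (simp add: pprt_def)
    qed
    fix t F assume F: "finite F" "card F = Suc k" "\<And>i. i \<in> F \<Longrightarrow> t \<le> pprt (v i - ?c)"
    then have "F \<noteq> {}" by auto
    from le_pprt_common_lower_bound[where a = "\<lambda>i. v i - ?c" and t = t, OF F(1) this F(3)]
    obtain b where b: "\<And>i. i \<in> F \<Longrightarrow> b \<le> v i - ?c" "t \<le> pprt b" by blast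
    \<comment> \<open>Summing \<open>b \<le> v i - ?c\<close> over the \<open>Suc k\<close> members
      of \<open>F\<close> subtracts exactly \<open>u\<close>, which the partial sum cannot
      exceed.\<close>
    have "real (Suc k) *\<^sub>R b = (\<Sum>i\<in>F. b)" using F by (simp add: sum_constant_scaleR)
    also have "\<dots> \<le> (\<Sum>i\<in>F. v i - ?c)" using b by (intro sum_mono) auto
    also have "\<dots> = sum v F - real (Suc k) *\<^sub>R ?c"
      using F by (simp add: sum_subtractf sum_constant_scaleR del: scaleR_scaleR)
    also have "\<dots> \<le> 0" using sum_le[OF F(1)] by simp
    finally have "(1 / real (Suc k)) *\<^sub>R (real (Suc k) *\<^sub>R b) \<le> (1 / real (Suc k)) *\<^sub>R 0"
      by (intro scaleR_left_mono) auto
    then have "b \<le> 0" by simp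
    with b(2) show "t \<le> 0" by simp
  qed simp
  show ?thesis
  proof (rule LIMSEQ_I)
    fix e :: real assume e: "0 < e"
    obtain k where k: "norm u / real (Suc k) < e / 2"
    proof -
      obtain k where "norm u / (e / 2) < real k" using reals_Archimedean2 by blast
      then have "norm u / real (Suc k) < e / 2"
        using e by (simp add: field_simps)
      then show ?thesis by (rule that)
    qed
    from LIMSEQ_D[OF approx[of k], of "e / 2"] e
    obtain N where N: "\<And>n. n \<ge> N \<Longrightarrow> norm (pprt (v n - (1 / real (Suc k)) *\<^sub>R u)) < e / 2" by auto
    have "norm (v n - 0) < e" if "n \<ge> N" for n
    proof -
      let ?c = "(1 / real (Suc k)) *\<^sub>R u"
      have "v n - ?c \<le> pprt (v n - ?c)" by (simp add: pprt_def)
      then have "norm (v n) \<le> norm (pprt (v n - ?c) + ?c)"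
        using v by (intro norm_mono_nonneg) (auto simp: diff_le_eq)
      also have "\<dots> \<le> norm (pprt (v n - ?c)) + norm ?c" by (rule norm_triangle_ineq)
      also have "norm ?c = norm u / real (Suc k)" by simp
      finally show ?thesis using N[OF that] k unfolding diff_zero by linarith
    qed
    then show "\<exists>N. \<forall>n\<ge>N. norm (v n - 0) < e" by blast
  qed
qed

text \<open>If \<open>s\<close> were not Cauchy, successive drops along a subsequence would have
  norm at least \<open>e\<close>. They are positive and telescope to at most \<open>u\<close>, so
  \<open>tendsto_0_of_bounded_partial_sums\<close> makes them norm null.\<close>

lemma convergent_of_antimono:
  fixes s :: "nat \<Rightarrow> 'a::banach_lattice"
  assumes u: "disjointly_null_below u" and s: "\<And>n. 0 \<le> s n" "s 0 \<le> u" "antimono s"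
  shows "convergent s"
proof (rule ccontr)
  assume "\<not> convergent s"
  then have "\<not> Cauchy s" by (simp add: Cauchy_convergent_iff)
  then obtain e where e: "e > 0" "\<And>N. \<exists>m\<ge>N. \<exists>n\<ge>N. e \<le> norm (s m - s n)"
    by (force simp: Cauchy_def dist_norm not_less)
  have "\<exists>k>N. e \<le> norm (s N - s k)" for N
  proof -
    \<comment> \<open>Monotonicity lets the start of the gap be moved back to \<open>N\<close>
      without decreasing its norm.\<close>
    have *: "\<exists>k>N. e \<le> norm (s N - s k)" if "N \<le> m" "m \<le> n" "e \<le> norm (s m - s n)" for m n
    proof -
      have "norm (s m - s n) \<le> norm (s N - s n)"
        using that s(3) by (intro norm_mono_nonneg) (auto simp: antimono_def intro: diff_right_mono)
      with that have le: "e \<le> norm (s N - s n)" by simp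
      with e(1) have "n \<noteq> N" by auto
      with that le show ?thesis by (intro exI[of _ n]) auto
    qed
    obtain m n where "m \<ge> N" "n \<ge> N" "e \<le> norm (s m - s n)" using e(2) by blast
    then show ?thesis
      using *[of m n] *[of n m] by (cases "m \<le> n") (auto simp: norm_minus_commute)
  qed
  then obtain h where h: "\<And>N. h N > N" "\<And>N. e \<le> norm (s N - s (h N))" by metis
  define r where "r n = (h ^^ n) 0" for n
  have r: "strict_mono r" using h(1) by (simp add: strict_mono_Suc_iff r_def)
  define v where "v n = s (r n) - s (r (Suc n))" for n
  have v0: "0 \<le> v n" for n
    using s(3) strict_mono_less_eq[OF r, of n "Suc n"] by (simp add: v_def antimono_def)
  have "v \<longlonglongrightarrow> 0"
  proof (rule tendsto_0_of_bounded_partial_sums[OF u v0])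
    fix F :: "nat set" assume "finite F"
    then obtain n where n: "F \<subseteq> {..<n}" using finite_nat_iff_bounded by blast
    have "sum v F \<le> sum v {..<n}" using n v0 by (intro sum_mono2) auto
    also have "\<dots> = s (r 0) - s (r n)" unfolding v_def by (rule sum_lessThan_telescope')
    also have "\<dots> \<le> s 0" using s(1) by (simp add: r_def)
    finally show "sum v F \<le> u" using s(2) by simp
  qed
  moreover have "e \<le> norm (v n)" for n using h(2)[of "r n"] by (simp add: v_def r_def)
  ultimately have "e \<le> 0"
    using tendsto_lowerbound[OF tendsto_norm[of v 0 sequentially], of e] by auto
  then show False using e by simp
qed

section \<open>Positive weakly null sequences\<close>

text \<open>A subsequence of \<open>inf u (x n)\<close> bounded away from \<open>0\<close> is made disjoint by subtracting from each
  term a large multiple of all later ones. The norm stays large because each term is normed by a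
  positive functional that is small on the later terms; the infinite subtraction converges because
  decreasing sequences do.\<close>

lemma tendsto_0_order_bounded:
  fixes x :: "nat \<Rightarrow> 'a::banach_lattice"
  assumes u: "disjointly_null_below u" "0 \<le> u" and x: "weakly_null x" "\<And>n. 0 \<le> x n"
  shows "(\<lambda>n. inf u (x n)) \<longlonglongrightarrow> 0"
proof (rule ccontr)
  define w where "w n = inf u (x n)" for n
  have w: "0 \<le> w n" "w n \<le> u" "w n \<le> x n" for n using u x by (auto simp: w_def)
  assume "\<not> (\<lambda>n. inf u (x n)) \<longlonglongrightarrow> 0"
  then obtain e where e: "e > 0" "\<And>N. \<exists>n\<ge>N. e \<le> norm (w n)"
    by (force simp: LIMSEQ_def not_less w_def)
  obtain f :: "nat \<Rightarrow> 'a \<Rightarrow>\<^sub>L real" where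
    f: "\<And>n. f n (w n) = norm (w n)" "\<And>n y. 0 \<le> y \<Longrightarrow> 0 \<le> f n y" "\<And>n y. \<bar>f n y\<bar> \<le> norm y"
  proof -
    have "\<exists>f :: 'a \<Rightarrow>\<^sub>L real. f (w n) = norm (w n) \<and> (\<forall>y\<ge>0. 0 \<le> f y) \<and> (\<forall>y. \<bar>f y\<bar> \<le> norm y)" for n
      using positive_norming_functional[OF w(1)[of n]] by metis
    then have "\<exists>f. \<forall>n. blinfun_apply (f n) (w n) = norm (w n) \<and> (\<forall>y\<ge>0. 0 \<le> f n y)
        \<and> (\<forall>y. \<bar>blinfun_apply (f n) y\<bar> \<le> norm y)"
      by (intro choice allI)
    then show ?thesis using that by blast
  qed
  have f_mono: "f n y \<le> f n z" if "y \<le> z" for n y z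
    using f(2)[of "z - y" n] that by (simp add: blinfun.diff_right)
  have f0: "(\<lambda>n. f i (w n)) \<longlonglongrightarrow> 0" for i
  proof (rule tendsto_sandwich[OF _ _ tendsto_const])
    show "(\<lambda>n. f i (x n)) \<longlonglongrightarrow> 0" using x(1) by (simp add: weakly_null_iff)
  qed (use f(2) f_mono w in \<open>auto intro!: always_eventually\<close>)
  \<comment> \<open>Subtracting \<open>u / K\<close> will cost at most \<open>e / 4\<close>;
    \<open>K \<ge> 1\<close> serves the disjointness estimate.\<close>
  obtain K :: real where K: "K \<ge> 1" "norm u / K \<le> e / 4"
  proof (rule that[of "max 1 (norm u * 4 / e)"])
    show "norm u / max 1 (norm u * 4 / e) \<le> e / 4"
      using e(1) by (simp add: divide_simps max_def)
  qed simp
  define q where "q n = (1/2::real) ^ n" for n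
  have q: "0 < q n" for n by (simp add: q_def)
  have q_sum: "(\<Sum>m<M. q (n + Suc m)) \<le> 1" for n M
  proof -
    have "(\<Sum>m<M. q (n + Suc m)) \<le> (\<Sum>m<M. (1/2) ^ Suc m)"
      by (intro sum_mono) (auto simp: q_def intro!: power_decreasing)
    also have "\<dots> \<le> 1"
      using sum_gp_strict[of "1/2::real" M] by (simp flip: sum_divide_distrib)
    finally show ?thesis .
  qed
  \<comment> \<open>The factor \<open>1 / K\<close> offsets the multiple \<open>K\<close> of the
    later terms in \<open>s\<close>; by \<open>q_sum\<close> they cost at most \<open>e / 4\<close>
    under the functional norming \<open>z n\<close>. After also paying for \<open>u / K\<close>, at
    least \<open>e / 2\<close> survives.\<close>
  have "0 < e / (4 * K) * q n" for n using e K q by (intro mult_pos_pos divide_pos_pos) auto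
  from subsequence_with_small_interaction[of "\<lambda>i n. f i (w n)" "\<lambda>n. e / (4 * K) * q n", OF f0 this e(2)]
  obtain r where r: "\<And>n. e \<le> norm (w (r n))"
    "\<And>j n. j < n \<Longrightarrow> f (r j) (w (r n)) < e / (4 * K) * q n" by metis
  define z where "z n = w (r n)" for n
  have z: "0 \<le> z n" "z n \<le> u" for n using w by (auto simp: z_def)
  \<comment> \<open>For \<open>n < m\<close> let \<open>d = z n - K *\<^sub>R z m\<close>. The
    multiple \<open>K\<close> of \<open>z m\<close> puts the earlier limit below
    \<open>pprt d\<close>; since \<open>z n \<le> u\<close>, subtracting \<open>u / K\<close> puts
    the later one below \<open>pprt (- d)\<close>.\<close>
  define s where "s n M = pprt (z n - K *\<^sub>R (\<Sum>m<M. z (n + Suc m)) - (1 / K) *\<^sub>R u)" for n M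
  have s0: "0 \<le> s n M" for n M by (simp add: s_def)
  have Ku: "0 \<le> (1 / K) *\<^sub>R u" using K u by (simp add: scaleR_nonneg_nonneg)
  have anti: "antimono (s n)" for n
    unfolding s_def
    by (intro antimonoI pprt_mono diff_mono order_refl scaleR_left_mono sum_mono2) (use z K in auto)
  have s_le_u: "s n M \<le> u" for n M
  proof -
    have "s n M \<le> s n 0" using anti by (simp add: antimono_def)
    also have "z n - (1 / K) *\<^sub>R u \<le> u"
      using z(2)[of n] Ku by (meson diff_mono diff_zero order_refl order_trans le_diff_eq add_increasing2)
    then have "s n 0 \<le> u" using u(2) by (simp add: s_def pprt_def)
    finally show ?thesis .
  qed
  have "convergent (s n)" for n
    by (rule convergent_of_antimono[OF u(1) s0 s_le_u anti])
  then obtain y where y: "\<And>n. s n \<longlonglongrightarrow> y n" unfolding convergent_def by metis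
  have y_le: "y n \<le> s n M" for n M
  proof (rule tendsto_upperbound_lattice[OF y])
    show "\<forall>\<^sub>F L in sequentially. s n L \<le> s n M"
      using eventually_ge_at_top[of M] by eventually_elim (use anti in \<open>auto simp: antimono_def\<close>)
  qed simp
  have y0: "0 \<le> y n" for n
    by (rule tendsto_lowerbound_lattice[OF y]) (auto simp: s0)
  have disj: "inf (y n) (y m) = 0" if "n < m" for n m
  proof (rule antisym)
    define d where "d = z n - K *\<^sub>R z m"
    obtain j where j: "m = n + Suc j" using \<open>n < m\<close> less_iff_Suc_add by auto
    have "y n \<le> s n (Suc j)" by (rule y_le)
    also have "\<dots> \<le> pprt d"
    proof -
      have "z m \<le> (\<Sum>m<Suc j. z (n + Suc m))"
        using sum_mono2[of "{..<Suc j}" "{j}" "\<lambda>m. z (n + Suc m)"] z by (simp add: j)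
      then have "K *\<^sub>R z m \<le> K *\<^sub>R (\<Sum>m<Suc j. z (n + Suc m))"
        using K by (intro scaleR_left_mono) auto
      then have "z n - K *\<^sub>R (\<Sum>m<Suc j. z (n + Suc m)) - (1 / K) *\<^sub>R u \<le> z n - K *\<^sub>R z m - 0"
        using Ku by (intro diff_mono order_refl)
      then show ?thesis unfolding s_def d_def by (intro pprt_mono) simp
    qed
    finally have 1: "y n \<le> pprt d" .
    have "y m \<le> s m 0" by (rule y_le)
    also have "\<dots> \<le> pprt ((1 / K) *\<^sub>R (- d))"
    proof -
      have "(1 / K) *\<^sub>R z n \<le> (1 / K) *\<^sub>R u" using K z by (intro scaleR_left_mono) auto
      moreover have "(1 / K) *\<^sub>R (- d) = z m - (1 / K) *\<^sub>R z n"
        using K by (simp add: d_def scaleR_diff_right)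
      ultimately show ?thesis unfolding s_def by (intro pprt_mono) simp
    qed
    also have "\<dots> \<le> pprt (- d)"
    proof -
      have "(1 / K) *\<^sub>R (- d) \<le> (1 / K) *\<^sub>R pprt (- d)"
        using K by (intro scaleR_left_mono) (auto simp: pprt_def)
      also have "\<dots> \<le> 1 *\<^sub>R pprt (- d)" using K by (intro scaleR_right_mono) auto
      finally show ?thesis by (simp only: pprt_def[of "(1 / K) *\<^sub>R (- d)"] le_supI zero_le_pprt scaleR_one)
    qed
    finally have "y m \<le> pprt (- d)" .
    with 1 show "inf (y n) (y m) \<le> 0" using inf_mono[of "y n" "pprt d" "y m" "pprt (- d)"] by (simp add: inf_pprt_neg)
  qed (simp add: y0)
  have "disjoint_seq y"
    unfolding disjoint_seq_def
  proof (intro allI impI)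
    fix m n :: nat assume "m \<noteq> n"
    then show "inf \<bar>y m\<bar> \<bar>y n\<bar> = 0"
      using disj[of m n] disj[of n m] y0 by (cases "m < n") (auto simp: inf_commute)
  qed
  moreover have "y n \<le> u" for n using y_le s_le_u order_trans by blast
  ultimately have "y \<longlonglongrightarrow> 0" using u(1) y0 by (simp add: disjointly_null_below_def)
  moreover have "e / 2 \<le> norm (y n)" for n
  proof -
    let ?f = "f (r n)"
    have "e / 2 \<le> norm (s n M)" for M
    proof -
      have "K * ?f (\<Sum>m<M. z (n + Suc m)) = (\<Sum>m<M. K * ?f (z (n + Suc m)))"
        by (simp add: blinfun.sum_right sum_distrib_left)
      also have "\<dots> \<le> (\<Sum>m<M. e / 4 * q (n + Suc m))"
      proof (rule sum_mono)
        fix m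
        have "K * ?f (z (n + Suc m)) \<le> K * (e / (4 * K) * q (n + Suc m))"
          using r(2)[of n "n + Suc m"] K by (intro mult_left_mono) (auto simp: z_def)
        also have "\<dots> = e / 4 * q (n + Suc m)" using K by simp
        finally show "K * ?f (z (n + Suc m)) \<le> e / 4 * q (n + Suc m)" .
      qed
      also have "\<dots> = e / 4 * (\<Sum>m<M. q (n + Suc m))" by (simp add: sum_distrib_left)
      also have "\<dots> \<le> e / 4 * 1" using e q_sum by (intro mult_left_mono) auto
      finally have 1: "K * ?f (\<Sum>m<M. z (n + Suc m)) \<le> e / 4" by simp
      have "(1 / K) * ?f u \<le> (1 / K) * norm u"
        using f(3)[of "r n" u] K by (intro mult_left_mono) (auto simp: abs_le_iff)
      also have "\<dots> = norm u / K" by simp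
      also note K(2)
      finally have 2: "(1 / K) * ?f u \<le> e / 4" .
      have "e \<le> ?f (z n)" using r(1) f(1) by (simp add: z_def)
      then have "e / 2 \<le> ?f (z n - K *\<^sub>R (\<Sum>m<M. z (n + Suc m)) - (1 / K) *\<^sub>R u)"
        using 1 2 by (simp only: blinfun.diff_right blinfun.scaleR_right real_scaleR_def)
      also have "\<dots> \<le> ?f (s n M)" by (rule f_mono) (simp add: s_def pprt_def)
      also have "\<dots> \<le> norm (s n M)" using f(3)[of "r n" "s n M"] by (simp add: abs_le_iff)
      finally show ?thesis .
    qed
    then show ?thesis by (intro tendsto_lowerbound[OF tendsto_norm[OF y]]) auto
  qed
  ultimately have "e / 2 \<le> 0"
    using tendsto_lowerbound[OF tendsto_norm[of y 0 sequentially], of "e / 2"] by auto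
  then show False using e by simp
qed

lemma weakly_null_L_weakly_compact_imp_norm_null:
  fixes x :: "nat \<Rightarrow> 'a::banach_lattice"
  assumes x: "weakly_null x" "\<And>n. 0 \<le> x n"
    and L: "L_weakly_compact A" "\<And>n. x n \<in> A"
  shows "x \<longlonglongrightarrow> 0"
proof -
  have null: "y \<longlonglongrightarrow> 0" if "disjoint_seq y" "\<And>n. 0 \<le> y n" "\<And>n. \<exists>m. y n \<le> x m" for y
  proof -
    have "y n \<in> solid_hull A" for n
    proof -
      obtain m where "y n \<le> x m" using \<open>\<And>n. \<exists>m. y n \<le> x m\<close> by blast
      then show ?thesis using L(2)[of m] x(2)[of m] that(2)[of n] unfolding solid_hull_def
        by (auto intro!: bexI[of _ "x m"])
    qed
    then show ?thesis using L(1) that(1) by (auto simp: L_weakly_compact_def)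
  qed
  have "disjointly_null_below (x i)" for i
    unfolding disjointly_null_below_def
  proof (intro allI impI)
    fix y :: "nat \<Rightarrow> 'a" assume "disjoint_seq y" "\<forall>n. 0 \<le> y n \<and> y n \<le> x i"
    then show "y \<longlonglongrightarrow> 0" by (intro null) auto
  qed
  then show ?thesis
    by (rule tendsto_0_of_almost_disjoint[OF x(2) tendsto_0_order_bounded[OF _ x(2) x] null])
qed

section \<open>Operators and the positive Schur property\<close>

lemma L_weakly_compact_of_positive_Schur:
  fixes A :: "'e::banach_lattice set"
  assumes "positive_Schur_property TYPE('e)" "disjointly_weakly_compact A"
  shows "L_weakly_compact A"
  unfolding L_weakly_compact_def
proof (intro conjI allI impI)
  show "bounded A" using assms(2) by (simp add: disjointly_weakly_compact_def)
  fix x :: "nat \<Rightarrow> 'e" assume x: "disjoint_seq x \<and> range x \<subseteq> solid_hull A"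
  then have "disjoint_seq (\<lambda>n. \<bar>x n\<bar>) \<and> range (\<lambda>n. \<bar>x n\<bar>) \<subseteq> solid_hull A"
    by (simp add: disjoint_seq_def solid_hull_def image_subset_iff)
  then have "weakly_null (\<lambda>n. \<bar>x n\<bar>)"
    using assms(2) by (simp add: disjointly_weakly_compact_def)
  then have "(\<lambda>n. \<bar>x n\<bar>) \<longlonglongrightarrow> 0"
    using assms(1) by (simp add: positive_Schur_property_def)
  then show "x \<longlonglongrightarrow> 0"
    by (simp add: tendsto_norm_zero_iff[of x, symmetric] norm_abs_lattice tendsto_norm_zero_iff[of "\<lambda>n. \<bar>x n\<bar>", symmetric])
qed

text \<open>\<open>T\<close> is evaluated at the positive vectors
  \<open>\<bar>a n\<bar> + c * a n\<close> with \<open>c = 1\<close> and \<open>c = - 1\<close>, one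
  for each half of the bound.\<close>

lemma abs_positive_operator_le:
  fixes T :: "(nat \<Rightarrow> real) \<Rightarrow> 'e::banach_lattice"
  assumes T: "bounded_operator ell1 T" "positive_on_ell1 T" and a: "a \<in> ns_carrier ell1"
  shows "\<bar>T a\<bar> \<le> T (\<lambda>n. \<bar>a n\<bar>)"
proof -
  have abs: "(\<lambda>n. \<bar>a n\<bar>) \<in> ns_carrier ell1" using a by (simp add: carrier_ell1_iff)
  have "T (\<lambda>n. \<bar>a n\<bar> + c * a n) = T (\<lambda>n. \<bar>a n\<bar>) + c *\<^sub>R T a" for c
    using T(1) a abs unfolding bounded_operator_def ell1_def by (auto simp: summable_mult abs_mult)
  moreover have "0 \<le> T (\<lambda>n. \<bar>a n\<bar> + c * a n)" if "\<bar>c\<bar> = 1" for c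
  proof -
    have "0 \<le> \<bar>a n\<bar> + c * a n" for n using that by (auto simp: abs_if split: if_splits)
    moreover have "(\<lambda>n. \<bar>a n\<bar> + c * a n) \<in> ns_carrier ell1"
      using a summable_abs_add[of "\<lambda>n. \<bar>a n\<bar>" "\<lambda>n. c * a n"]
      by (simp add: carrier_ell1_iff abs_mult summable_mult)
    ultimately show ?thesis using T(2) by (simp add: positive_on_ell1_def)
  qed
  ultimately have "0 \<le> T (\<lambda>n. \<bar>a n\<bar>) + c *\<^sub>R T a" if "\<bar>c\<bar> = 1" for c using that by metis
  from this[of 1] this[of "- 1"]
  have "0 \<le> T (\<lambda>n. \<bar>a n\<bar>) - - T a" "0 \<le> T (\<lambda>n. \<bar>a n\<bar>) - T a" by simp_all
  then show ?thesis unfolding diff_ge_0_iff_ge by (intro abs_leI)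
qed

text \<open>Passing from \<open>a n\<close> to its modulus stays in the ball of \<open>ell1\<close>
  and, by positivity, dominates \<open>\<bar>T (a n)\<bar>\<close>. So the dominating vectors lie in
  the relatively weakly compact image itself, not just in its solid hull.\<close>

lemma disjointly_weakly_compact_of_positive_weakly_compact:
  fixes T :: "(nat \<Rightarrow> real) \<Rightarrow> 'e::banach_lattice"
  assumes pos: "positive_on_ell1 T" and wc: "weakly_compact_operator ell1 T"
  shows "disjointly_weakly_compact_operator ell1 T"
  unfolding disjointly_weakly_compact_operator_def disjointly_weakly_compact_def
proof (intro conjI allI impI)
  show T: "bounded_operator ell1 T" using wc by (simp add: weakly_compact_operator_def)
  obtain K where K: "\<forall>a\<in>ns_carrier ell1. norm (T a) \<le> K * ns_norm ell1 a"
    using T by (auto simp: bounded_operator_def)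
  show "bounded (T ` ns_ball ell1)"
  proof (rule boundedI)
    fix y assume "y \<in> T ` ns_ball ell1"
    then obtain a where a: "a \<in> ns_carrier ell1" "ns_norm ell1 a \<le> 1" "y = T a" by (auto simp: ns_ball_def)
    have "0 \<le> ns_norm ell1 a" using a by (simp add: ell1_def suminf_nonneg)
    then have "K * ns_norm ell1 a \<le> \<bar>K\<bar> * 1" using a by (intro mult_mono) auto
    with bspec[OF K a(1)] a(3) show "norm y \<le> \<bar>K\<bar>" by simp
  qed
  fix x :: "nat \<Rightarrow> 'e" assume x: "disjoint_seq x \<and> range x \<subseteq> solid_hull (T ` ns_ball ell1)"
  then have "\<forall>n. \<exists>a\<in>ns_ball ell1. \<bar>x n\<bar> \<le> \<bar>T a\<bar>" by (auto simp: solid_hull_def image_subset_iff)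
  then obtain a where a: "\<And>n. a n \<in> ns_ball ell1" "\<And>n. \<bar>x n\<bar> \<le> \<bar>T (a n)\<bar>" by metis
  show "weakly_null x"
  proof (rule weakly_null_of_dominated_by_relatively_weakly_compact)
    show "relatively_weakly_compact (T ` ns_ball ell1)" using wc by (simp add: weakly_compact_operator_def)
    show "disjoint_seq x" using x by simp
    fix n
    have "(\<lambda>k. \<bar>a n k\<bar>) \<in> ns_ball ell1" using a(1)[of n] by (simp add: ball_ell1_eq)
    then show "T (\<lambda>k. \<bar>a n k\<bar>) \<in> T ` ns_ball ell1" by blast
    have "a n \<in> ns_carrier ell1" using a(1)[of n] by (simp add: ns_ball_def)
    then show "\<bar>x n\<bar> \<le> T (\<lambda>k. \<bar>a n k\<bar>)"
      using a(2) abs_positive_operator_le[OF T pos] order_trans by blast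
  qed
qed

lemma positive_Schur_of_operators:
  assumes L: "\<And>T :: (nat \<Rightarrow> real) \<Rightarrow> 'e::banach_lattice.
    \<lbrakk>positive_on_ell1 T; weakly_compact_operator ell1 T\<rbrakk> \<Longrightarrow> L_weakly_compact_operator ell1 T"
  shows "positive_Schur_property TYPE('e)"
  unfolding positive_Schur_property_def
proof (intro allI impI, elim conjE)
  fix x :: "nat \<Rightarrow> 'e" assume x: "\<forall>n. 0 \<le> x n" "weakly_null x"
  obtain K where K: "0 \<le> K" "\<And>n. norm (x n) \<le> K"
    using positive_weakly_null_bounded[OF x(2)] x(1) by blast
  have "positive_on_ell1 (combination x)"
    unfolding positive_on_ell1_def combination_def
    using summable_combination[OF K] x(1)
    by (auto intro!: suminf_nonneg_lattice scaleR_nonneg_nonneg)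
  from L[OF this weakly_compact_operator_combination[OF x(2) K]]
  have "L_weakly_compact (combination x ` ns_ball ell1)"
    by (simp add: L_weakly_compact_operator_def)
  moreover have "x n \<in> combination x ` ns_ball ell1" for n
  proof
    let ?\<delta> = "\<lambda>k. if k = n then 1 else 0 :: real"
    have "(\<lambda>k. ?\<delta> k *\<^sub>R x k) = (\<lambda>k. if k = n then x k else 0)" by auto
    then show "x n = combination x ?\<delta>"
      unfolding combination_def by (simp add: sums_unique[OF sums_single])
    have "(\<lambda>k. \<bar>?\<delta> k\<bar>) = (\<lambda>k. if k = n then 1 else 0)" by auto
    then show "?\<delta> \<in> ns_ball ell1"
      using sums_single[of n "\<lambda>k. 1::real"]
      by (auto simp: ns_ball_def ell1_def sums_iff)
  qed
  ultimately show "x \<longlonglongrightarrow> 0"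
    using x by (intro weakly_null_L_weakly_compact_imp_norm_null) auto
qed

section \<open>Transport of \<open>ell1\<close> into the universe of the first statement\<close>

lemma image_ball_ell1_copy:
  assumes f: "inj f"
  shows "(\<lambda>u. T (inv f u)) ` ns_ball (ell1_copy f) = T ` ns_ball ell1"
proof -
  have "ns_ball (ell1_copy f) = f ` ns_ball ell1"
    using f by (auto simp: ns_ball_def ell1_copy_def ell1_def)
  then show ?thesis using f by (simp add: image_image)
qed

lemma bounded_operator_ell1_copy:
  assumes f: "inj f" and T: "bounded_operator ell1 T"
  shows "bounded_operator (ell1_copy f) (\<lambda>u. T (inv f u))"
  using f T unfolding bounded_operator_def by (simp add: ell1_copy_def ell1_def)

theorem proposition3p16:
  shows "((\<forall>(X :: ('x + (nat \<Rightarrow> real)) nspace) (T :: 'x + (nat \<Rightarrow> real) \<Rightarrow> 'e::banach_lattice).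
              banach_space X \<and> disjointly_weakly_compact_operator X T
                \<longrightarrow> L_weakly_compact_operator X T)
            \<longleftrightarrow> positive_Schur_property TYPE('e))
       \<and> ((\<forall>T :: (nat \<Rightarrow> real) \<Rightarrow> 'e.
              positive_on_ell1 T \<and> disjointly_weakly_compact_operator ell1 T
                \<longrightarrow> L_weakly_compact_operator ell1 T)
            \<longleftrightarrow> positive_Schur_property TYPE('e))
       \<and> ((\<forall>T :: (nat \<Rightarrow> real) \<Rightarrow> 'e.
              positive_on_ell1 T \<and> weakly_compact_operator ell1 T
                \<longrightarrow> L_weakly_compact_operator ell1 T)
            \<longleftrightarrow> positive_Schur_property TYPE('e))"
    (is "(?S1 \<longleftrightarrow> ?S4) \<and> (?S2 \<longleftrightarrow> ?S4) \<and> (?S3 \<longleftrightarrow> ?S4)")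
proof -
  have 41: ?S1 if ?S4
    using L_weakly_compact_of_positive_Schur[OF that]
    by (simp add: disjointly_weakly_compact_operator_def L_weakly_compact_operator_def)
  have 12: ?S2 if S1: ?S1
  proof (intro allI impI, elim conjE)
    fix T :: "(nat \<Rightarrow> real) \<Rightarrow> 'e" assume T: "disjointly_weakly_compact_operator ell1 T"
    \<comment> \<open>The second summand of the universe holds the copy of \<open>ell1\<close>.
      \<open>T\<close> read through \<open>inv Inr\<close> maps its ball onto the same set, and
      apart from boundedness of the operator both compactness notions depend only on that
      set.\<close>
    let ?X = "ell1_copy (Inr :: (nat \<Rightarrow> real) \<Rightarrow> 'x + (nat \<Rightarrow> real))"
    let ?T = "\<lambda>u :: 'x + (nat \<Rightarrow> real). T (inv Inr u)"
    have "bounded_operator ?X ?T"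
      using T by (intro bounded_operator_ell1_copy inj_Inr) (simp add: disjointly_weakly_compact_operator_def)
    then have "disjointly_weakly_compact_operator ?X ?T"
      using T by (simp add: disjointly_weakly_compact_operator_def image_ball_ell1_copy)
    with S1 have "L_weakly_compact_operator ?X ?T"
      using banach_space_ell1_copy[OF inj_Inr] by blast
    with T show "L_weakly_compact_operator ell1 T"
      by (simp add: disjointly_weakly_compact_operator_def L_weakly_compact_operator_def image_ball_ell1_copy)
  qed
  have 23: ?S3 if ?S2
    using that disjointly_weakly_compact_of_positive_weakly_compact by blast
  have 34: ?S4 if ?S3
    using that positive_Schur_of_operators by blast
  show ?thesis using 41 12 23 34 by blast
qed

end
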